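(* There exists a family of unsatisfiable CNF formulas $\tau'_n$ such that the size of the shortest $164$-SRC-I proof of $\tau'_n$ is polynomial, but the size of the shortest SR-II proof of $\tau'_n$ is exponential.
   Context: The size of a proof is its number of steps; "polynomial" means $\mathcal{O}(\mathrm{poly}(n))$ and "exponential" means $2^{\Omega(n)}$ (the paper's convention for exponential separations). A clause is a disjunction (set) of literals. For $k\ge1$, a $k$-symmetry is a bijection $\phi$ of literals onto literals with $\phi(\lnot x)=\lnot\phi(x)$ and $\phi(x)=x$ for all variables $x$ except at most $k$ of them; it acts on clauses literal by literal. It is positive if it maps variables to variables (without negation). A $k$-SRC-II proof (Resolution with local $k$-symmetries) of an unsatisfiable CNF is a sequence of clauses ending with the empty clause, each of which is an input clause, or is obtained from earlier clauses by the resolution rule (from $A\lor x$ and $B\lor\lnot x$ infer $A\lor B$), or is obtained by the symmetry rule: if a clause $A$ was inferred earlier in the proof from $B_1,\dots,B_l$, and $\phi$ is a $k$-symmetry such that all $B_i$ and all $\phi(B_i)$ are input clauses, infer $\phi(A)$ in one step. $k$-SRC-I (global) requires instead that both sets $\{B_i\}$ and $\{\phi(B_i)\}$ be equal to the set of all input clauses. $k$-SR-II is $k$-SRC-II with all symmetries required to be positive. Omitting the prefix $k$ (as in SR-II) means $k$ equals the number of variables. There is no weakening rule. *)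

theory Defs
  imports Complex_Main "HOL-Library.Landau_Symbols"
begin

datatype 'v lit = Pos 'v | Neg 'v

fun var_of :: "'v lit \<Rightarrow> 'v" where
  "var_of (Pos x) = x"
| "var_of (Neg x) = x"

fun negate :: "'v lit \<Rightarrow> 'v lit" where
  "negate (Pos x) = Neg x"
| "negate (Neg x) = Pos x"

type_synonym 'v clause = "'v lit set"
type_synonym 'v cnf = "'v clause set"

definition is_cnf :: "'v cnf \<Rightarrow> bool" where
  "is_cnf F \<longleftrightarrow> finite F \<and> (\<forall>C\<in>F. finite C)"

fun lit_true :: "('v \<Rightarrow> bool) \<Rightarrow> 'v lit \<Rightarrow> bool" where
  "lit_true a (Pos x) \<longleftrightarrow> a x"
| "lit_true a (Neg x) \<longleftrightarrow> \<not> a x"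

definition unsatisfiable :: "'v cnf \<Rightarrow> bool" where
  "unsatisfiable F \<longleftrightarrow> \<not> (\<exists>a. \<forall>C\<in>F. \<exists>l\<in>C. lit_true a l)"

definition vars :: "'v cnf \<Rightarrow> 'v set" where
  "vars F = var_of ` \<Union>F"

definition lits :: "'v cnf \<Rightarrow> 'v lit set" where
  "lits F = Pos ` vars F \<union> Neg ` vars F"

text \<open>Symmetries act on the literals over the variables of the formula; the values of
  the HOL function elsewhere are irrelevant.\<close>

definition k_symmetry :: "nat \<Rightarrow> 'v cnf \<Rightarrow> ('v lit \<Rightarrow> 'v lit) \<Rightarrow> bool" where
  "k_symmetry k F \<phi> \<longleftrightarrow>
     bij_betw \<phi> (lits F) (lits F) \<and>
     (\<forall>l\<in>lits F. \<phi> (negate l) = negate (\<phi> l)) \<and>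
     card {x \<in> vars F. \<phi> (Pos x) \<noteq> Pos x} \<le> k"

definition positive :: "'v cnf \<Rightarrow> ('v lit \<Rightarrow> 'v lit) \<Rightarrow> bool" where
  "positive F \<phi> \<longleftrightarrow> (\<forall>x\<in>vars F. \<exists>y. \<phi> (Pos x) = Pos y)"

definition resolvent :: "'v \<Rightarrow> 'v clause \<Rightarrow> 'v clause \<Rightarrow> 'v clause" where
  "resolvent x C D = (C - {Pos x}) \<union> (D - {Neg x})"

text \<open>A line \<open>(S, C)\<close> of a derivation consists of the inferred clause \<open>C\<close> together with
  the set \<open>S\<close> of input clauses from which it is inferred. Inferring \<open>C\<close> from
  \<open>B\<^sub>1, \<dots>, B\<^sub>l\<close> need not use every \<open>B\<^sub>i\<close>, so the set \<open>B = {B\<^sub>1, \<dots>, B\<^sub>l}\<close> in the symmetry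
  rule may be any superset of \<open>S\<close> that is admissible for \<open>\<phi>\<close>. A clause obtained by the
  symmetry rule is inferred from the images of the original input clauses (recording
  the original ones instead would make iterated use of the local rule unsound).\<close>

inductive derivation ::
  "(('v lit \<Rightarrow> 'v lit) \<Rightarrow> 'v cnf \<Rightarrow> bool) \<Rightarrow> 'v cnf \<Rightarrow> ('v cnf \<times> 'v clause) list \<Rightarrow> bool"
  for adm :: "('v lit \<Rightarrow> 'v lit) \<Rightarrow> 'v cnf \<Rightarrow> bool" and F :: "'v cnf"
where
  empty: "derivation adm F []"
| input: "derivation adm F \<pi> \<Longrightarrow> C \<in> F \<Longrightarrow> derivation adm F (\<pi> @ [({C}, C)])"
| resolution:
    "derivation adm F \<pi> \<Longrightarrow> (S, C) \<in> set \<pi> \<Longrightarrow> (T, D) \<in> set \<pi> \<Longrightarrow> Pos x \<in> C \<Longrightarrow> Neg x \<in> D \<Longrightarrow>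
     derivation adm F (\<pi> @ [(S \<union> T, resolvent x C D)])"
| symmetry:
    "derivation adm F \<pi> \<Longrightarrow> (S, A) \<in> set \<pi> \<Longrightarrow> S \<subseteq> B \<Longrightarrow> adm \<phi> B \<Longrightarrow>
     derivation adm F (\<pi> @ [((`) \<phi> ` S, \<phi> ` A)])"

definition refutation ::
  "(('v lit \<Rightarrow> 'v lit) \<Rightarrow> 'v cnf \<Rightarrow> bool) \<Rightarrow> 'v cnf \<Rightarrow> ('v cnf \<times> 'v clause) list \<Rightarrow> bool" where
  "refutation adm F \<pi> \<longleftrightarrow> derivation adm F \<pi> \<and> \<pi> \<noteq> [] \<and> snd (last \<pi>) = {}"

definition SRC_I_proof :: "nat \<Rightarrow> 'v cnf \<Rightarrow> ('v cnf \<times> 'v clause) list \<Rightarrow> bool" where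
  "SRC_I_proof k F =
     refutation (\<lambda>\<phi> B. k_symmetry k F \<phi> \<and> B = F \<and> (`) \<phi> ` B = F) F"

definition k_SR_II_proof :: "nat \<Rightarrow> 'v cnf \<Rightarrow> ('v cnf \<times> 'v clause) list \<Rightarrow> bool" where
  "k_SR_II_proof k F =
     refutation (\<lambda>\<phi> B. k_symmetry k F \<phi> \<and> positive F \<phi> \<and> B \<subseteq> F \<and> (`) \<phi> ` B \<subseteq> F) F"

definition SR_II_proof :: "'v cnf \<Rightarrow> ('v cnf \<times> 'v clause) list \<Rightarrow> bool" where
  "SR_II_proof F = k_SR_II_proof (card (vars F)) F"

text \<open>Every step, including the listing of an input clause, counts. For an unsatisfiable
  CNF the minimum is attained, as already plain resolution is complete.\<close>

definition shortest_size :: "(('v cnf \<times> 'v clause) list \<Rightarrow> bool) \<Rightarrow> nat" where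
  "shortest_size P = (LEAST s. \<exists>\<pi>. P \<pi> \<and> length \<pi> = s)"

definition polynomial :: "(nat \<Rightarrow> nat) \<Rightarrow> bool" where
  "polynomial f \<longleftrightarrow> (\<exists>d::nat. (\<lambda>n. real (f n)) \<in> O(\<lambda>n. real n ^ d))"

text \<open>Growth of order \<open>2\<close> to the power \<open>\<Omega>(n)\<close>.\<close>

definition exponential :: "(nat \<Rightarrow> nat) \<Rightarrow> bool" where
  "exponential f \<longleftrightarrow>
     (\<exists>c::real. c > 0 \<and> (\<forall>\<^sub>F n in sequentially. real (f n) \<ge> 2 powr (c * real n)))"

end

theory Submission
  imports Defs "HOL-Library.Countable" "HOL-Library.Nat_Bijection"
begin

text \<open>The formulas are Tseitin formulas of square grids, padded so that any two clauses differ in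
  their numbers of positive and negative literals. A positive symmetry preserves these numbers and
  hence fixes every premise, so SR-II cannot beat plain resolution on them. Plain resolution is
  exponential by a random restriction: freezing half of the lines with random values kills every
  clause that touches many lines, whereas every refutation of the remaining grid contains a clause
  touching all live rows or all live columns, because otherwise an adversary could always move the
  unique violated vertex away along an untouched line. On the other hand, complementing the edges
  of a face of the grid is a global symmetry moving boundedly many variables. Setting the edges outside
  a spanning tree to false makes the formula easy, which gives a short derivation of the disjunction
  of these edges, and the face flips remove them from this clause one by one.\<close>

section \<open>Derivations\<close>

text \<open>The padding must meet two opposing demands: positive symmetries have to be rigid on the
  premises, yet complementing a face must still permute them, although it turns positive occurrences
  of edges into negative ones. So the padding of an edge flips along with it: \<open>Z e k\<close>
  is exchanged with the negation of \<open>Y e k\<close>. An edge then counts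
  \<open>2 ^ colour e\<close> on the positive or the negative side, and as \<open>colour\<close> is
  injective at every vertex, the negative count encodes the set of true edges in binary. The sum of
  both counts is invariant under flips and identifies the vertex. Fixing the premises is not yet
  enough: a local symmetry may still permute variables that the chosen premises treat alike, such as
  the copies at one edge. An invariant on such twins shows that falsified clauses are nevertheless
  left unchanged. A chosen literal thus lies on a frozen line and is true with probability 1/4,
  which is the origin of the rate 4/3.\<close>

lemma negate_negate [simp]: "negate (negate l) = l"
  by (cases l) auto

lemma var_of_negate [simp]: "var_of (negate l) = var_of l"
  by (cases l) auto

lemma lit_true_negate [simp]: "lit_true a (negate l) \<longleftrightarrow> \<not> lit_true a l"
  by (cases l) auto

lemma mem_lits_iff: "l \<in> lits F \<longleftrightarrow> var_of l \<in> vars F"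
  by (cases l) (auto simp: lits_def)

lemma clause_subset_lits: "C \<in> F \<Longrightarrow> C \<subseteq> lits F"
  by (auto simp: mem_lits_iff vars_def intro!: imageI)

lemma finite_vars: "is_cnf F \<Longrightarrow> finite (vars F)"
  by (auto simp: is_cnf_def vars_def)

definition falsified :: "('v \<Rightarrow> bool) \<Rightarrow> 'v clause \<Rightarrow> bool" where
  "falsified a C \<longleftrightarrow> (\<forall>l\<in>C. \<not> lit_true a l)"

lemma falsified_resolvent:
  assumes "falsified a (resolvent x C D)"
  shows "falsified a C \<or> falsified a D"
  using assms by (cases "a x") (auto simp: falsified_def resolvent_def)

lemma lit_true_upd: "var_of l \<noteq> x \<Longrightarrow> lit_true (a(x := b)) l \<longleftrightarrow> lit_true a l"
  by (cases l) auto

lemma falsified_upd: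
  assumes "x \<notin> var_of ` C"
  shows "falsified (a(x := b)) C \<longleftrightarrow> falsified a C"
proof -
  have "var_of l \<noteq> x" if "l \<in> C" for l using assms that by blast
  then show ?thesis by (simp add: falsified_def lit_true_upd)
qed

lemma mem_var_of_image_iff: "x \<in> var_of ` C \<longleftrightarrow> Pos x \<in> C \<or> Neg x \<in> C"
proof
  assume "x \<in> var_of ` C"
  then obtain l where "l \<in> C" "var_of l = x" by auto
  then show "Pos x \<in> C \<or> Neg x \<in> C" by (cases l) auto
qed force

lemma falsified_not_tautology: "falsified a C \<Longrightarrow> l \<in> C \<Longrightarrow> negate l \<notin> C"
  by (metis falsified_def lit_true_negate)

lemma derivation_append:
  assumes "derivation adm F \<pi>" "derivation adm F \<pi>'"
  shows "derivation adm F (\<pi> @ \<pi>')"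
  using assms(2)
proof induction
  case empty
  then show ?case using assms(1) by simp
next
  case (input \<pi>' C)
  then show ?case using derivation.input[of adm F "\<pi> @ \<pi>'" C] by simp
next
  case (resolution \<pi>' S C T D x)
  then show ?case using derivation.resolution[of adm F "\<pi> @ \<pi>'" S C T D x] by simp
next
  case (symmetry \<pi>' S A B \<phi>)
  then show ?case using derivation.symmetry[of adm F "\<pi> @ \<pi>'" S A B \<phi>] by simp
qed

text \<open>A refutation has to end with the empty clause. Prefixes of derivations are derivations,
  so the list can be cut after an occurrence of \<open>{}\<close>.\<close>

lemma refutation_of_derivation:
  assumes "derivation adm F \<pi>" "{} \<in> snd ` set \<pi>"
  shows "\<exists>\<pi>'. refutation adm F \<pi>' \<and> length \<pi>' \<le> length \<pi>"
proof -
  have step: "\<exists>\<pi>'. refutation adm F \<pi>' \<and> length \<pi>' \<le> length (\<pi> @ [(S, A)])"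
    if "{} \<in> snd ` set \<pi> \<Longrightarrow> \<exists>\<pi>'. refutation adm F \<pi>' \<and> length \<pi>' \<le> length \<pi>"
      "derivation adm F (\<pi> @ [(S, A)])" "{} \<in> snd ` set (\<pi> @ [(S, A)])" for \<pi> S A
  proof (cases "{} \<in> snd ` set \<pi>")
    case True
    then show ?thesis using that(1) by fastforce
  next
    case False
    then have "A = {}" using that(3) by auto
    then have "refutation adm F (\<pi> @ [(S, A)])" using that(2) by (simp add: refutation_def)
    then show ?thesis by blast
  qed
  show ?thesis
    using assms
  proof induction
    case empty
    then show ?case by simp
  next
    case (input \<pi> C)
    show ?case by (rule step) (fact input.IH derivation.input[OF input.hyps] input.prems)+
  next
    case (resolution \<pi> S C T D x)
    show ?case
      by (rule step) (fact resolution.IH derivation.resolution[OF resolution.hyps] resolution.prems)+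
  next
    case (symmetry \<pi> S A B \<phi>)
    show ?case
      by (rule step) (fact symmetry.IH derivation.symmetry[OF symmetry.hyps] symmetry.prems)+
  qed
qed

text \<open>Both invariants serve the symmetry rule: the sources stay among the inputs, and the
  clauses stay within the literals on which \<open>\<phi>\<close> is known to be a
  bijection.\<close>

lemma derivation_lits:
  assumes "derivation adm F \<pi>"
    and "\<And>\<phi> B. adm \<phi> B \<Longrightarrow> bij_betw \<phi> (lits F) (lits F) \<and> B \<subseteq> F \<and> (`) \<phi> ` B \<subseteq> F"
    and "(S, A) \<in> set \<pi>"
  shows "S \<subseteq> F \<and> A \<subseteq> lits F"
  using assms(1,3)
proof (induction arbitrary: S A)
  case empty
  then show ?case by simp
next
  case (input \<pi> C S A)
  then show ?case
    using input.IH[of S A] clause_subset_lits[of C F] by (cases "(S, A) \<in> set \<pi>") simp_all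
next
  case (resolution \<pi> S C T D x S' A')
  have "S \<subseteq> F \<and> C \<subseteq> lits F" "T \<subseteq> F \<and> D \<subseteq> lits F"
    using resolution.IH resolution.hyps(2,3) by blast+
  then have "S \<union> T \<subseteq> F \<and> resolvent x C D \<subseteq> lits F" by (auto simp: resolvent_def)
  then show ?case
    using resolution.prems resolution.IH[of S' A'] by (cases "(S', A') \<in> set \<pi>") simp_all
next
  case (symmetry \<pi> S A B \<phi> S' A')
  note \<phi> = assms(2)[OF symmetry.hyps(4)]
  have "A \<subseteq> lits F" using symmetry.IH symmetry.hyps(2) by blast
  then have "\<phi> ` A \<subseteq> lits F" using \<phi> by (metis bij_betw_imp_surj_on image_mono)
  moreover have "(`) \<phi> ` S \<subseteq> F" using \<phi> symmetry.hyps(3) by blast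
  ultimately show ?case
    using symmetry.prems symmetry.IH[of S' A'] by (cases "(S', A') \<in> set \<pi>") simp_all
qed

text \<open>A satisfying assignment pulls back along \<open>\<phi>\<close> to another one, because
  \<open>\<phi>\<close> maps \<open>F\<close> to itself; so soundness is proved for all satisfying
  assignments at once. This turns the short refutations of the Tseitin formulas into a proof of
  their unsatisfiability.\<close>

lemma SRC_I_sound:
  assumes "SRC_I_proof k F \<pi>"
  shows "unsatisfiable F"
proof -
  let ?adm = "\<lambda>\<phi> B. k_symmetry k F \<phi> \<and> B = F \<and> (`) \<phi> ` B = F"
  have \<pi>: "derivation ?adm F \<pi>" "\<pi> \<noteq> []" "snd (last \<pi>) = {}"
    using assms by (auto simp: SRC_I_proof_def refutation_def)
  have adm: "bij_betw \<phi> (lits F) (lits F) \<and> B \<subseteq> F \<and> (`) \<phi> ` B \<subseteq> F" if "?adm \<phi> B" for \<phi> B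
    using that unfolding k_symmetry_def by blast
  have sound: "\<not> falsified a A"
    if "derivation ?adm F \<pi>" "(S, A) \<in> set \<pi>" "\<forall>C\<in>F. \<not> falsified a C" for \<pi> S A a
    using that
  proof (induction arbitrary: S A a)
    case empty
    then show ?case by simp
  next
    case (input \<pi> C S A a)
    then show ?case by (cases "(S, A) \<in> set \<pi>") simp_all
  next
    case (resolution \<pi> S C T D x S' A a)
    show ?case
    proof (cases "(S', A) \<in> set \<pi>")
      case True
      then show ?thesis using resolution.IH resolution.prems(2) by blast
    next
      case False
      then have "A = resolvent x C D" using resolution.prems by simp
      then show ?thesis using resolution.IH resolution.hyps resolution.prems(2) falsified_resolvent by metis
    qed
  next
    case (symmetry \<pi> S A B \<phi> S' A' a)
    show ?case
    proof (cases "(S', A') \<in> set \<pi>")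
      case True
      then show ?thesis using symmetry.IH symmetry.prems(2) by blast
    next
      case False
      then have A': "A' = \<phi> ` A" using symmetry.prems by auto
      have lits: "A \<subseteq> lits F"
        using derivation_lits[OF symmetry.hyps(1) adm symmetry.hyps(2)] by blast
      have neg: "\<phi> (negate l) = negate (\<phi> l)" if "l \<in> lits F" for l
        using symmetry.hyps(4) that by (simp add: k_symmetry_def)
      define a' where "a' = (\<lambda>x. lit_true a (\<phi> (Pos x)))"
      have a': "lit_true a' l \<longleftrightarrow> lit_true a (\<phi> l)" if "l \<in> lits F" for l
      proof (cases l)
        case (Neg x)
        then have "\<phi> (Pos x) = negate (\<phi> l)" using neg[OF that] by simp
        then show ?thesis using Neg by (simp add: a'_def)
      qed (simp add: a'_def)
      have "\<not> falsified a' C" if "C \<in> F" for C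
      proof -
        have "\<phi> ` C \<in> F" using symmetry.hyps(4) that by blast
        then have "\<not> falsified a (\<phi> ` C)" using symmetry.prems(2) by blast
        then show ?thesis using a' clause_subset_lits[OF that] by (fastforce simp: falsified_def)
      qed
      then have "\<not> falsified a' A" using symmetry.IH symmetry.hyps(2) by blast
      then show ?thesis using a' lits A' by (fastforce simp: falsified_def)
    qed
  qed
  have "\<exists>C\<in>F. falsified a C" for a
  proof (rule ccontr)
    assume "\<not> ?thesis"
    moreover have "(fst (last \<pi>), {}) \<in> set \<pi>"
      using last_in_set[OF \<pi>(2)] \<pi>(3) by (metis prod.collapse)
    ultimately have "\<not> falsified a {}" using sound[OF \<pi>(1)] by blast
    then show False by (simp add: falsified_def)
  qed
  then show ?thesis by (auto simp: unsatisfiable_def falsified_def)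
qed

text \<open>A bound on all proofs passes to \<open>shortest_size\<close>, a \<open>LEAST\<close>,
  only if some proof exists; plain resolution supplies one for every \<open>adm\<close>.\<close>

lemma resolution_complete:
  assumes "is_cnf F" "unsatisfiable F"
  shows "\<exists>\<pi>. refutation adm F \<pi>"
proof -
  \<comment> \<open>The variables of \<open>U\<close> are eliminated one by one. As the claim holds
    for all \<open>a\<close>, it gives clauses for both values of the next variable; they are
    resolved on it unless one of them already omits it.\<close>
  have "\<exists>\<pi> S C. derivation adm F \<pi> \<and> (S, C) \<in> set \<pi> \<and> falsified a C \<and> C \<subseteq> lits F \<and> var_of ` C \<inter> U = {}"
    if "finite U" for U a
    using that
  proof (induction arbitrary: a)
    case empty
    obtain C where C: "C \<in> F" "falsified a C"
      using assms(2) by (auto simp: unsatisfiable_def falsified_def)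
    have "derivation adm F [({C}, C)]"
      using derivation.input[OF derivation.empty C(1)] by simp
    then show ?case using C clause_subset_lits[OF C(1)]
      by (intro exI[of _ "[({C}, C)]"] exI[of _ "{C}"] exI[of _ C]) simp
  next
    case (insert x U)
    obtain \<pi> S C where C: "derivation adm F \<pi>" "(S, C) \<in> set \<pi>" "falsified (a(x := True)) C"
      "C \<subseteq> lits F" "var_of ` C \<inter> U = {}" using insert.IH by blast
    obtain \<rho> T D where D: "derivation adm F \<rho>" "(T, D) \<in> set \<rho>" "falsified (a(x := False)) D"
      "D \<subseteq> lits F" "var_of ` D \<inter> U = {}" using insert.IH by blast
    have Pos: "Pos x \<notin> C" and Neg: "Neg x \<notin> D"
      using C(3) D(3) unfolding falsified_def by force+
    show ?case
    proof (cases "x \<in> var_of ` C")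
      case False
      then have "falsified a C" using C(3) by (simp add: falsified_upd)
      then show ?thesis using C False by blast
    next
      case xC: True
      then have NC: "Neg x \<in> C" using Pos by (simp add: mem_var_of_image_iff)
      show ?thesis
      proof (cases "x \<in> var_of ` D")
        case False
        then have "falsified a D" using D(3) by (simp add: falsified_upd)
        then show ?thesis using D False by blast
      next
        case True
        then have PD: "Pos x \<in> D" using Neg by (simp add: mem_var_of_image_iff)
        let ?R = "resolvent x D C"
        have "derivation adm F ((\<pi> @ \<rho>) @ [(T \<union> S, ?R)])"
          using derivation.resolution[OF derivation_append[OF C(1) D(1)], of T D S C x] C(2) D(2) PD NC
          by simp
        moreover have x: "x \<noteq> var_of l" if "l \<in> ?R" for l
          using that Pos Neg by (cases l) (auto simp: resolvent_def)
        have "falsified a ?R"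
          unfolding falsified_def
        proof
          fix l assume l: "l \<in> ?R"
          then have "l \<in> C \<or> l \<in> D" by (auto simp: resolvent_def)
          then show "\<not> lit_true a l"
            using C(3) D(3) x[OF l] by (auto simp: falsified_def lit_true_upd)
        qed
        moreover have R: "?R \<subseteq> C \<union> D" by (auto simp: resolvent_def)
        then have "?R \<subseteq> lits F" using C(4) D(4) by blast
        moreover have "x \<notin> var_of ` ?R" using x by blast
        then have "var_of ` ?R \<inter> insert x U = {}"
          using C(5) D(5) R by blast
        ultimately show ?thesis
          by (intro exI[of _ "(\<pi> @ \<rho>) @ [(T \<union> S, ?R)]"] exI[of _ "T \<union> S"] exI[of _ ?R]) simp
      qed
    qed
  qed
  from this[OF finite_vars[OF assms(1)], of "\<lambda>_. True"]
  obtain \<pi> S C where C: "derivation adm F \<pi>" "(S, C) \<in> set \<pi>" "C \<subseteq> lits F"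
    "var_of ` C \<inter> vars F = {}" by blast
  then have "C = {}" unfolding mem_lits_iff subset_eq by blast
  then have "{} \<in> snd ` set \<pi>" using C(2) by (metis image_eqI snd_conv)
  then show ?thesis using refutation_of_derivation[OF C(1)] by blast
qed

section \<open>Derivations with a length budget\<close>

text \<open>The source sets are forgotten: in the global system the symmetry rule only asks that
  they consist of inputs, which always holds. \<open>K\<close> may be any part of the derived
  clauses.\<close>

definition derivable_within ::
  "(('v lit \<Rightarrow> 'v lit) \<Rightarrow> 'v cnf \<Rightarrow> bool) \<Rightarrow> 'v cnf \<Rightarrow> nat \<Rightarrow> 'v clause set \<Rightarrow> bool" where
  "derivable_within adm F k K \<longleftrightarrow>
     (\<exists>\<pi>. derivation adm F \<pi> \<and> K \<subseteq> snd ` set \<pi> \<and> length \<pi> \<le> k)"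

lemma derivable_within_empty: "derivable_within adm F 0 {}"
  using derivation.empty by (auto simp: derivable_within_def)

lemma derivable_within_mono: "derivable_within adm F k K \<Longrightarrow> k \<le> k' \<Longrightarrow> derivable_within adm F k' K"
  unfolding derivable_within_def by (meson order_trans)

lemma derivable_within_input:
  assumes "derivable_within adm F k K" "C \<in> F"
  shows "derivable_within adm F (Suc k) (insert C K)"
proof -
  obtain \<pi> where \<pi>: "derivation adm F \<pi>" "K \<subseteq> snd ` set \<pi>" "length \<pi> \<le> k"
    using assms(1) by (auto simp: derivable_within_def)
  then show ?thesis
    using derivation.input[OF \<pi>(1) assms(2)] unfolding derivable_within_def
    by (intro exI[of _ "\<pi> @ [({C}, C)]"]) auto
qed

lemma derivable_within_resolvent:
  assumes "derivable_within adm F k K" "C \<in> K" "D \<in> K" "Pos x \<in> C" "Neg x \<in> D"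
  shows "derivable_within adm F (Suc k) (insert (resolvent x C D) K)"
proof -
  obtain \<pi> where \<pi>: "derivation adm F \<pi>" "K \<subseteq> snd ` set \<pi>" "length \<pi> \<le> k"
    using assms(1) by (auto simp: derivable_within_def)
  obtain S T where "(S, C) \<in> set \<pi>" "(T, D) \<in> set \<pi>" using \<pi>(2) assms(2,3) by fastforce
  then show ?thesis
    using derivation.resolution[OF \<pi>(1) _ _ assms(4,5)] \<pi> unfolding derivable_within_def
    by (intro exI[of _ "\<pi> @ [(S \<union> T, resolvent x C D)]"]) auto
qed

lemma derivable_within_global_symmetry:
  fixes F :: "'v cnf" and k :: nat
  defines "adm \<equiv> \<lambda>\<phi> B. k_symmetry k F \<phi> \<and> B = F \<and> (`) \<phi> ` B = F"
  assumes "derivable_within adm F m K" "C \<in> K" "k_symmetry k F \<phi>" "(`) \<phi> ` F = F"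
  shows "derivable_within adm F (Suc m) (insert (\<phi> ` C) K)"
proof -
  obtain \<pi> where \<pi>: "derivation adm F \<pi>" "K \<subseteq> snd ` set \<pi>" "length \<pi> \<le> m"
    using assms(2) by (auto simp: derivable_within_def)
  obtain S where S: "(S, C) \<in> set \<pi>" using \<pi>(2) assms(3) by fastforce
  have "S \<subseteq> F"
    using derivation_lits[OF \<pi>(1) _ S] by (auto simp: adm_def k_symmetry_def)
  then have "derivation adm F (\<pi> @ [((`) \<phi> ` S, \<phi> ` C)])"
    using derivation.symmetry[OF \<pi>(1) S, of F \<phi>] assms(4,5) by (simp add: adm_def)
  then show ?thesis using \<pi> unfolding derivable_within_def
    by (intro exI[of _ "\<pi> @ [((`) \<phi> ` S, \<phi> ` C)]"]) auto
qed

lemma refutation_of_derivable_within: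
  assumes "derivable_within adm F k K" "{} \<in> K"
  shows "\<exists>\<pi>. refutation adm F \<pi> \<and> length \<pi> \<le> k"
  using assms refutation_of_derivation unfolding derivable_within_def
  by (metis order_trans subsetD)

text \<open>The goals are reached by increasing rank, and those already reached persist because
  \<open>G\<close> is monotone in the available clauses.\<close>

lemma derivable_within_ranked:
  fixes rank :: "'i \<Rightarrow> nat"
  assumes "finite I" "derivable_within adm F k K"
    and mono: "\<And>i K' K''. G i K' \<Longrightarrow> K' \<subseteq> K'' \<Longrightarrow> G i K''"
    and step: "\<And>i k' K'. i \<in> I \<Longrightarrow> K \<subseteq> K' \<Longrightarrow> derivable_within adm F k' K' \<Longrightarrow>
      (\<And>j. j \<in> I \<Longrightarrow> rank j < rank i \<Longrightarrow> G j K') \<Longrightarrow>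
      \<exists>K''. K' \<subseteq> K'' \<and> derivable_within adm F (k' + c) K'' \<and> G i K''"
  shows "\<exists>K'. K \<subseteq> K' \<and> derivable_within adm F (k + c * card I) K' \<and> (\<forall>i\<in>I. G i K')"
proof -
  \<comment> \<open>The induction runs over sets \<open>J\<close> closed under smaller rank;
    removing an element of maximal rank preserves this.\<close>
  have "\<exists>K'. K \<subseteq> K' \<and> derivable_within adm F (k + c * card J) K' \<and> (\<forall>i\<in>J. G i K')"
    if "J \<subseteq> I" "\<And>i j. i \<in> J \<Longrightarrow> j \<in> I \<Longrightarrow> rank j < rank i \<Longrightarrow> j \<in> J" for J
    using that
  proof (induction "card J" arbitrary: J)
    case 0
    then have "J = {}" using finite_subset[OF 0(2) assms(1)] by simp
    then show ?case using assms(2) by auto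
  next
    case (Suc m)
    have J: "finite J" "J \<noteq> {}" using Suc.hyps(2) card.infinite by fastforce+
    obtain i where i: "i \<in> J" "rank i = Max (rank ` J)"
      using Max_in[of "rank ` J"] J by fastforce
    then have max: "rank j \<le> rank i" if "j \<in> J" for j
      using J(1) that by simp
    have "\<exists>K'. K \<subseteq> K' \<and> derivable_within adm F (k + c * card (J - {i})) K' \<and> (\<forall>j\<in>J - {i}. G j K')"
    proof (rule Suc.hyps(1))
      show "m = card (J - {i})" using Suc.hyps(2) i J by simp
      show "J - {i} \<subseteq> I" using Suc.prems(1) by blast
      show "j \<in> J - {i}" if "i' \<in> J - {i}" "j \<in> I" "rank j < rank i'" for i' j
        using Suc.prems(2)[of i' j] that max[of i'] by auto
    qed
    then obtain K' where K': "K \<subseteq> K'" "derivable_within adm F (k + c * card (J - {i})) K'"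
      "\<forall>j\<in>J - {i}. G j K'" by blast
    have "G j K'" if "j \<in> I" "rank j < rank i" for j
      using K'(3) Suc.prems(2)[OF i(1) that] that by auto
    then obtain K'' where K'': "K' \<subseteq> K''" "derivable_within adm F (k + c * card (J - {i}) + c) K''" "G i K''"
      using step[OF _ K'(1,2)] i(1) Suc.prems(1) by blast
    have "card J = Suc (card (J - {i}))" using Suc.hyps(2) i J by simp
    then have "k + c * card J = k + c * card (J - {i}) + c" by simp
    moreover have "\<forall>j\<in>J. G j K''" using K'(3) K''(1,3) mono by blast
    ultimately show ?case using K' K'' by (metis subset_trans)
  qed
  from this[of I] show ?thesis by blast
qed

text \<open>One resolution per literal of \<open>L\<close> that is present. The side literals
  \<open>Q\<close> are known only up to \<open>\<Pi>\<close>, so the result is enclosed between two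
  bounds; the lower one guarantees that the literals to be kept survive. Disjointness of
  \<open>L\<close> from \<open>\<Pi>\<close> prevents removed literals from returning.\<close>

lemma derivable_within_eliminate:
  assumes "finite L" "derivable_within adm F k K" "C \<in> K" "L \<inter> \<Pi> = {}"
    and "\<And>l. l \<in> L \<Longrightarrow> \<exists>Q\<subseteq>\<Pi>. insert (negate l) Q \<in> K"
  shows "\<exists>C' K'. K \<subseteq> K' \<and> C' \<in> K' \<and> derivable_within adm F (k + card L) K' \<and>
    C - L \<subseteq> C' \<and> C' \<subseteq> (C - L) \<union> \<Pi>"
  using assms
proof (induction L)
  case empty
  then show ?case by auto
next
  case (insert l L)
  obtain C' K' where K': "K \<subseteq> K'" "C' \<in> K'" "derivable_within adm F (k + card L) K'"
    "C - L \<subseteq> C'" "C' \<subseteq> (C - L) \<union> \<Pi>" using insert by force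
  obtain Q where Q: "Q \<subseteq> \<Pi>" "insert (negate l) Q \<in> K'" using insert.prems(4) K'(1) by blast
  show ?case
  proof (cases "l \<in> C'")
    case False
    moreover have "derivable_within adm F (k + card (insert l L)) K'"
      using derivable_within_mono[OF K'(3)] insert.hyps by auto
    ultimately show ?thesis using K' by blast
  next
    case True
    define R where "R = (C' - {l}) \<union> (insert (negate l) Q - {negate l})"
    have "derivable_within adm F (Suc (k + card L)) (insert R K')"
    proof (cases l)
      case (Pos x)
      then have "R = resolvent x C' (insert (negate l) Q)" by (simp add: R_def resolvent_def)
      then show ?thesis using derivable_within_resolvent[OF K'(3,2) Q(2)] True Pos by simp
    next
      case (Neg x)
      then have "R = resolvent x (insert (negate l) Q) C'" by (auto simp: R_def resolvent_def)
      then show ?thesis using derivable_within_resolvent[OF K'(3) Q(2) K'(2)] True Neg by simp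
    qed
    moreover have "C - insert l L \<subseteq> R" "R \<subseteq> (C - insert l L) \<union> \<Pi>"
      using K'(4,5) Q(1) insert.prems(3) by (auto simp: R_def)
    moreover have "Suc (k + card L) = k + card (insert l L)" using insert.hyps by simp
    ultimately show ?thesis using K'(1)
      by (metis insertI1 insertI2 subsetD subsetI)
  qed
qed

section \<open>Formulas whose clauses have distinct signatures\<close>

definition signature :: "'v clause \<Rightarrow> nat \<times> nat" where
  "signature C = (card {x. Pos x \<in> C}, card {x. Neg x \<in> C})"

text \<open>Variables with the same occurrences in the premises stay together in every derived
  clause that is not tautological in one of them; since a positive symmetry preserves
  signatures, it fixes every premise and only moves variables within such classes.\<close>

locale distinct_signatures =
  fixes F :: "'v cnf"
  assumes cnf: "is_cnf F" and sig: "inj_on signature F"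
begin

definition adm :: "('v lit \<Rightarrow> 'v lit) \<Rightarrow> 'v cnf \<Rightarrow> bool" where
  "adm = (\<lambda>\<phi> B. k_symmetry (card (vars F)) F \<phi> \<and> positive F \<phi> \<and> B \<subseteq> F \<and> (`) \<phi> ` B \<subseteq> F)"

lemma SR_II_proof_iff: "SR_II_proof F \<pi> \<longleftrightarrow> refutation adm F \<pi>"
  by (simp add: SR_II_proof_def k_SR_II_proof_def adm_def)

lemma derivation_adm_lits:
  "derivation adm F \<pi> \<Longrightarrow> (S, A) \<in> set \<pi> \<Longrightarrow> S \<subseteq> F \<and> A \<subseteq> lits F"
proof (erule derivation_lits[rotated 2])
  assume "derivation adm F \<pi>"
  then show "derivation adm F \<pi>" .
  show "bij_betw \<phi> (lits F) (lits F) \<and> B \<subseteq> F \<and> (`) \<phi> ` B \<subseteq> F" if "adm \<phi> B" for \<phi> B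
    using that unfolding adm_def k_symmetry_def by blast
qed

definition twins :: "'v cnf \<Rightarrow> 'v \<Rightarrow> 'v \<Rightarrow> bool" where
  "twins S x y \<longleftrightarrow> (\<forall>C\<in>S. (Pos x \<in> C \<longleftrightarrow> Pos y \<in> C) \<and> (Neg x \<in> C \<longleftrightarrow> Neg y \<in> C))"

text \<open>The exemption of variables with both signs is forced by resolution: if \<open>x\<close>
  and \<open>y\<close> are both positive in one clause and both negative in the other, resolving on
  \<open>x\<close> removes \<open>x\<close> but leaves \<open>y\<close> with both signs.\<close>

definition twin_closed :: "'v cnf \<Rightarrow> 'v clause \<Rightarrow> bool" where
  "twin_closed S A \<longleftrightarrow> (\<forall>x\<in>vars F. \<forall>y\<in>vars F. twins S x y \<longrightarrow>
     \<not> (Pos x \<in> A \<and> Neg x \<in> A) \<longrightarrow> \<not> (Pos y \<in> A \<and> Neg y \<in> A) \<longrightarrow>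
     (Pos x \<in> A \<longleftrightarrow> Pos y \<in> A) \<and> (Neg x \<in> A \<longleftrightarrow> Neg y \<in> A))"

lemma adm_renaming:
  assumes "adm \<phi> B"
  obtains \<sigma> where "bij_betw \<sigma> (vars F) (vars F)"
    "\<And>x. x \<in> vars F \<Longrightarrow> \<phi> (Pos x) = Pos (\<sigma> x) \<and> \<phi> (Neg x) = Neg (\<sigma> x)"
    "\<And>A x. A \<subseteq> lits F \<Longrightarrow> x \<in> vars F \<Longrightarrow> Pos (\<sigma> x) \<in> \<phi> ` A \<longleftrightarrow> Pos x \<in> A"
    "\<And>A x. A \<subseteq> lits F \<Longrightarrow> x \<in> vars F \<Longrightarrow> Neg (\<sigma> x) \<in> \<phi> ` A \<longleftrightarrow> Neg x \<in> A"
proof -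
  have ks: "k_symmetry (card (vars F)) F \<phi>" and pf: "positive F \<phi>"
    using assms by (simp_all add: adm_def)
  have neg: "\<forall>l\<in>lits F. \<phi> (negate l) = negate (\<phi> l)"
    using ks unfolding k_symmetry_def by (rule conjunct1[OF conjunct2])
  have "bij_betw \<phi> (lits F) (lits F)"
    using ks unfolding k_symmetry_def by (rule conjunct1)
  then have inj: "inj_on \<phi> (lits F)" and im: "\<phi> ` lits F = lits F"
    by (simp_all only: bij_betw_def)
  define \<sigma> where "\<sigma> x = var_of (\<phi> (Pos x))" for x
  have \<sigma>: "\<phi> (Pos x) = Pos (\<sigma> x) \<and> \<phi> (Neg x) = Neg (\<sigma> x)" if x: "x \<in> vars F" for x
  proof -
    obtain y where "\<phi> (Pos x) = Pos y" using pf x unfolding positive_def by blast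
    moreover have "\<phi> (negate (Pos x)) = negate (\<phi> (Pos x))"
      using x by (intro bspec[OF neg]) (simp add: mem_lits_iff)
    ultimately show ?thesis by (simp add: \<sigma>_def)
  qed
  have \<sigma>_in: "\<sigma> x \<in> vars F" if "x \<in> vars F" for x
  proof -
    have "\<phi> (Pos x) \<in> lits F" using im that by (metis imageI mem_lits_iff var_of.simps(1))
    then show ?thesis using \<sigma>[OF that] by (simp add: mem_lits_iff)
  qed
  have "inj_on \<sigma> (vars F)"
  proof
    fix x y assume xy: "x \<in> vars F" "y \<in> vars F" "\<sigma> x = \<sigma> y"
    then have "\<phi> (Pos x) = \<phi> (Pos y)" using \<sigma> by simp
    then show "x = y" using inj_onD[OF inj, of "Pos x" "Pos y"] xy by (simp add: mem_lits_iff)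
  qed
  moreover have "\<sigma> ` vars F \<subseteq> vars F" using \<sigma>_in by blast
  ultimately have bij: "bij_betw \<sigma> (vars F) (vars F)"
    using finite_vars[OF cnf] by (simp add: bij_betw_def endo_inj_surj)
  have mem: "\<phi> l \<in> \<phi> ` A \<longleftrightarrow> l \<in> A" if "A \<subseteq> lits F" "l \<in> lits F" for A l
    by (rule inj_on_image_mem_iff[OF inj that(2,1)])
  have \<sigma>_mem: "Pos (\<sigma> x) \<in> \<phi> ` A \<longleftrightarrow> Pos x \<in> A" "Neg (\<sigma> x) \<in> \<phi> ` A \<longleftrightarrow> Neg x \<in> A"
    if "A \<subseteq> lits F" "x \<in> vars F" for A x
    using mem[OF that(1), of "Pos x"] mem[OF that(1), of "Neg x"] \<sigma>[OF that(2)] that(2)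
    by (simp_all add: mem_lits_iff)
  show ?thesis by (rule that[OF bij \<sigma> \<sigma>_mem])
qed

lemma adm_fixes_premises:
  assumes "adm \<phi> B" "C \<in> B"
  shows "\<phi> ` C = C"
proof -
  obtain \<sigma> where \<sigma>: "bij_betw \<sigma> (vars F) (vars F)"
    "\<And>A x. A \<subseteq> lits F \<Longrightarrow> x \<in> vars F \<Longrightarrow> Pos (\<sigma> x) \<in> \<phi> ` A \<longleftrightarrow> Pos x \<in> A"
    "\<And>A x. A \<subseteq> lits F \<Longrightarrow> x \<in> vars F \<Longrightarrow> Neg (\<sigma> x) \<in> \<phi> ` A \<longleftrightarrow> Neg x \<in> A"
    using adm_renaming[OF assms(1)] by metis
  have CF: "C \<in> F" "\<phi> ` C \<in> F" using assms by (auto simp: adm_def)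
  have lits: "C \<subseteq> lits F" "\<phi> ` C \<subseteq> lits F" using CF clause_subset_lits by blast+
  have v: "x \<in> vars F" if "D \<subseteq> lits F" "Pos x \<in> D \<or> Neg x \<in> D" for x D
    using that by (metis mem_lits_iff subsetD var_of.simps)
  have "{x. Pos x \<in> \<phi> ` C} = \<sigma> ` {x. Pos x \<in> C}"
  proof (intro equalityI subsetI)
    fix y assume y: "y \<in> {x. Pos x \<in> \<phi> ` C}"
    then have "y \<in> \<sigma> ` vars F" using v[OF lits(2)] \<sigma>(1) by (simp add: bij_betw_def)
    then show "y \<in> \<sigma> ` {x. Pos x \<in> C}" using y \<sigma>(2)[OF lits(1)] by blast
  qed (use \<sigma>(2)[OF lits(1)] v[OF lits(1)] in blast)
  moreover have "{x. Neg x \<in> \<phi> ` C} = \<sigma> ` {x. Neg x \<in> C}"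
  proof (intro equalityI subsetI)
    fix y assume y: "y \<in> {x. Neg x \<in> \<phi> ` C}"
    then have "y \<in> \<sigma> ` vars F" using v[OF lits(2)] \<sigma>(1) by (simp add: bij_betw_def)
    then show "y \<in> \<sigma> ` {x. Neg x \<in> C}" using y \<sigma>(3)[OF lits(1)] by blast
  qed (use \<sigma>(3)[OF lits(1)] v[OF lits(1)] in blast)
  moreover have "{x. Pos x \<in> C} \<subseteq> vars F" "{x. Neg x \<in> C} \<subseteq> vars F" using v[OF lits(1)] by blast+
  then have "inj_on \<sigma> {x. Pos x \<in> C}" "inj_on \<sigma> {x. Neg x \<in> C}"
    using \<sigma>(1) inj_on_subset by (auto simp: bij_betw_def)
  ultimately have "signature (\<phi> ` C) = signature C" by (simp add: signature_def card_image)
  then show ?thesis using sig CF by (simp add: inj_on_def)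
qed

text \<open>Each premise in \<open>S\<close> equals its own image, so \<open>\<sigma> x\<close>
  occurs in it exactly as \<open>x\<close> does.\<close>

lemma adm_twins:
  assumes "adm \<phi> B" "S \<subseteq> B"
    and \<sigma>: "\<And>A x. A \<subseteq> lits F \<Longrightarrow> x \<in> vars F \<Longrightarrow> Pos (\<sigma> x) \<in> \<phi> ` A \<longleftrightarrow> Pos x \<in> A"
      "\<And>A x. A \<subseteq> lits F \<Longrightarrow> x \<in> vars F \<Longrightarrow> Neg (\<sigma> x) \<in> \<phi> ` A \<longleftrightarrow> Neg x \<in> A"
    and "x \<in> vars F"
  shows "twins S (\<sigma> x) x"
proof -
  have "B \<subseteq> F" using assms(1) by (simp add: adm_def)
  then have "\<phi> ` C = C \<and> C \<subseteq> lits F" if "C \<in> S" for C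
    using adm_fixes_premises[OF assms(1), of C] clause_subset_lits[of C F] subsetD[OF assms(2) that]
    by blast
  then show ?thesis using \<sigma> assms(5) unfolding twins_def by metis
qed

text \<open>Resolution only enlarges the set of premises, so twins of the resolvent are twins of
  both parents. A symmetry leaves \<open>S\<close> unchanged and moves each variable to a twin, so
  twins of the image pull back to twins.\<close>

lemma derivation_twin_closed:
  assumes "derivation adm F \<pi>" "(S, A) \<in> set \<pi>"
  shows "twin_closed S A"
  using assms
proof (induction arbitrary: S A)
  case empty
  then show ?case by simp
next
  case (input \<pi> C S A)
  have "twin_closed {C} C" by (auto simp: twin_closed_def twins_def)
  then show ?case using input.prems input.IH[of S A] by (cases "(S, A) \<in> set \<pi>") simp_all
next
  case (resolution \<pi> S C T D p S' A')
  have closed: "twin_closed S C" "twin_closed T D" using resolution.IH resolution.hyps(2,3) by blast+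
  have R: "Pos z \<in> resolvent p C D \<longleftrightarrow> Pos z \<in> C \<and> z \<noteq> p \<or> Pos z \<in> D"
    "Neg z \<in> resolvent p C D \<longleftrightarrow> Neg z \<in> C \<or> Neg z \<in> D \<and> z \<noteq> p" for z
    by (auto simp: resolvent_def)
  have "twin_closed (S \<union> T) (resolvent p C D)"
    unfolding twin_closed_def
  proof (intro ballI impI)
    fix x y assume xy: "x \<in> vars F" "y \<in> vars F" and tw: "twins (S \<union> T) x y"
      and nt: "\<not> (Pos x \<in> resolvent p C D \<and> Neg x \<in> resolvent p C D)"
        "\<not> (Pos y \<in> resolvent p C D \<and> Neg y \<in> resolvent p C D)"
    have "twins S x y" "twins T x y" using tw by (auto simp: twins_def)
    then have C: "\<not> (Pos x \<in> C \<and> Neg x \<in> C) \<longrightarrow> \<not> (Pos y \<in> C \<and> Neg y \<in> C) \<longrightarrow>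
        (Pos x \<in> C \<longleftrightarrow> Pos y \<in> C) \<and> (Neg x \<in> C \<longleftrightarrow> Neg y \<in> C)"
      and D: "\<not> (Pos x \<in> D \<and> Neg x \<in> D) \<longrightarrow> \<not> (Pos y \<in> D \<and> Neg y \<in> D) \<longrightarrow>
        (Pos x \<in> D \<longleftrightarrow> Pos y \<in> D) \<and> (Neg x \<in> D \<longleftrightarrow> Neg y \<in> D)"
      using closed xy unfolding twin_closed_def by blast+
    show "(Pos x \<in> resolvent p C D \<longleftrightarrow> Pos y \<in> resolvent p C D) \<and>
        (Neg x \<in> resolvent p C D \<longleftrightarrow> Neg y \<in> resolvent p C D)"
    proof (cases "p = x")
      case px: True
      show ?thesis
      proof (cases "p = y")
        case False
        have "(Pos y \<in> resolvent p C D \<longleftrightarrow> Pos y \<in> C \<or> Pos y \<in> D) \<and>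
            (Neg y \<in> resolvent p C D \<longleftrightarrow> Neg y \<in> C \<or> Neg y \<in> D)"
          using R False by blast
        moreover have "(Pos x \<in> resolvent p C D \<longleftrightarrow> Pos x \<in> D) \<and> (Neg x \<in> resolvent p C D \<longleftrightarrow> Neg x \<in> C)"
          using R px by blast
        moreover have "Pos x \<in> C" "Neg x \<in> D" using resolution.hyps(4,5) px by simp_all
        \<comment> \<open>If \<open>C\<close> and \<open>D\<close> were both free of conflicting
          signs in \<open>x\<close> and \<open>y\<close>, then \<open>y\<close> would be positive in
          \<open>C\<close> and negative in \<open>D\<close>, hence tautological in the resolvent,
          against \<open>nt\<close>.\<close>
        ultimately show ?thesis using C D nt by metis
      qed (use px in simp)
    next
      case px: False
      show ?thesis
      proof (cases "p = y")
        case True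
        have "(Pos x \<in> resolvent p C D \<longleftrightarrow> Pos x \<in> C \<or> Pos x \<in> D) \<and>
            (Neg x \<in> resolvent p C D \<longleftrightarrow> Neg x \<in> C \<or> Neg x \<in> D)"
          using R px by blast
        moreover have "(Pos y \<in> resolvent p C D \<longleftrightarrow> Pos y \<in> D) \<and> (Neg y \<in> resolvent p C D \<longleftrightarrow> Neg y \<in> C)"
          using R True by blast
        moreover have "Pos y \<in> C" "Neg y \<in> D" using resolution.hyps(4,5) True by simp_all
        ultimately show ?thesis using C D nt by metis
      next
        case False
        have "(Pos z \<in> resolvent p C D \<longleftrightarrow> Pos z \<in> C \<or> Pos z \<in> D) \<and>
            (Neg z \<in> resolvent p C D \<longleftrightarrow> Neg z \<in> C \<or> Neg z \<in> D)" if "z \<in> {x, y}" for z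
          using R px False that by blast
        then show ?thesis using C D nt by simp metis
      qed
    qed
  qed
  then show ?case
    using resolution.prems resolution.IH[of S' A'] by (cases "(S', A') \<in> set \<pi>") simp_all
next
  case (symmetry \<pi> S A B \<phi> S' A')
  show ?case
  proof (cases "(S', A') \<in> set \<pi>")
    case True
    then show ?thesis using symmetry.IH by blast
  next
    case False
    obtain \<sigma> where \<sigma>: "bij_betw \<sigma> (vars F) (vars F)"
      "\<And>A x. A \<subseteq> lits F \<Longrightarrow> x \<in> vars F \<Longrightarrow> Pos (\<sigma> x) \<in> \<phi> ` A \<longleftrightarrow> Pos x \<in> A"
      "\<And>A x. A \<subseteq> lits F \<Longrightarrow> x \<in> vars F \<Longrightarrow> Neg (\<sigma> x) \<in> \<phi> ` A \<longleftrightarrow> Neg x \<in> A"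
      using adm_renaming[OF symmetry.hyps(4)] by metis
    have lits: "A \<subseteq> lits F" using derivation_adm_lits[OF symmetry.hyps(1,2)] by blast
    have "\<phi> ` C = id C" if "C \<in> S" for C
      using adm_fixes_premises[OF symmetry.hyps(4)] symmetry.hyps(3) that by auto
    then have "(`) \<phi> ` S = id ` S" by (rule image_cong[OF refl])
    then have "(`) \<phi> ` S = S" by simp
    then have S': "S' = S" "A' = \<phi> ` A" using False symmetry.prems by auto
    have A: "twin_closed S A" using symmetry.IH symmetry.hyps(2) by blast
    show ?thesis
      unfolding twin_closed_def
    proof (intro ballI impI)
      fix x y assume xy: "x \<in> vars F" "y \<in> vars F" "twins S' x y"
        "\<not> (Pos x \<in> A' \<and> Neg x \<in> A')" "\<not> (Pos y \<in> A' \<and> Neg y \<in> A')"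
      obtain x' y' where x': "x' \<in> vars F" "x = \<sigma> x'" and y': "y' \<in> vars F" "y = \<sigma> y'"
        using xy(1,2) \<sigma>(1) unfolding bij_betw_def by blast
      have "twins S x' y'"
        using xy(3) adm_twins[OF symmetry.hyps(4,3) \<sigma>(2,3) x'(1)]
          adm_twins[OF symmetry.hyps(4,3) \<sigma>(2,3) y'(1)]
        unfolding S' x' y' twins_def by blast
      moreover have "\<not> (Pos x' \<in> A \<and> Neg x' \<in> A)" "\<not> (Pos y' \<in> A \<and> Neg y' \<in> A)"
        using xy(4,5) \<sigma>(2,3)[OF lits] x' y' S' by simp_all
      ultimately have "(Pos x' \<in> A \<longleftrightarrow> Pos y' \<in> A) \<and> (Neg x' \<in> A \<longleftrightarrow> Neg y' \<in> A)"
        using A x' y' unfolding twin_closed_def by blast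
      then show "(Pos x \<in> A' \<longleftrightarrow> Pos y \<in> A') \<and> (Neg x \<in> A' \<longleftrightarrow> Neg y \<in> A')"
        using \<sigma>(2,3)[OF lits] x' y' S' by simp
    qed
  qed
qed

text \<open>A falsified clause has no variable with both signs, so \<open>twin_closed\<close>
  applies without exemption: each variable moves to a twin, which occurs in \<open>A\<close> with
  the same sign. Thus \<open>\<phi>\<close> maps the finite set \<open>A\<close> injectively into
  itself.\<close>

lemma symmetry_trivial:
  assumes "derivation adm F \<pi>" "(S, A) \<in> set \<pi>" "S \<subseteq> B" "adm \<phi> B" "falsified a (\<phi> ` A)"
  shows "\<phi> ` A = A"
proof -
  obtain \<sigma> where \<sigma>: "bij_betw \<sigma> (vars F) (vars F)"
    "\<And>x. x \<in> vars F \<Longrightarrow> \<phi> (Pos x) = Pos (\<sigma> x) \<and> \<phi> (Neg x) = Neg (\<sigma> x)"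
    "\<And>A x. A \<subseteq> lits F \<Longrightarrow> x \<in> vars F \<Longrightarrow> Pos (\<sigma> x) \<in> \<phi> ` A \<longleftrightarrow> Pos x \<in> A"
    "\<And>A x. A \<subseteq> lits F \<Longrightarrow> x \<in> vars F \<Longrightarrow> Neg (\<sigma> x) \<in> \<phi> ` A \<longleftrightarrow> Neg x \<in> A"
    using adm_renaming[OF assms(4)] by metis
  have lits: "A \<subseteq> lits F" using derivation_adm_lits[OF assms(1,2)] by blast
  have closed: "twin_closed S A" using derivation_twin_closed[OF assms(1,2)] .
  have nontaut: "\<not> (Pos x \<in> A \<and> Neg x \<in> A)" if "x \<in> vars F" for x
    using falsified_not_tautology[OF assms(5), of "Pos (\<sigma> x)"] \<sigma>(3,4)[OF lits that] by auto
  have "\<phi> l \<in> A" if "l \<in> A" for l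
  proof -
    have x: "var_of l \<in> vars F" using lits that by (auto simp: mem_lits_iff)
    moreover have "\<sigma> (var_of l) \<in> vars F" using \<sigma>(1) x by (auto simp: bij_betw_def)
    ultimately have "(Pos (\<sigma> (var_of l)) \<in> A \<longleftrightarrow> Pos (var_of l) \<in> A) \<and>
        (Neg (\<sigma> (var_of l)) \<in> A \<longleftrightarrow> Neg (var_of l) \<in> A)"
      using closed nontaut adm_twins[OF assms(4,3) \<sigma>(3,4) x] unfolding twin_closed_def by blast
    then show ?thesis using that \<sigma>(2)[OF x] by (cases l) auto
  qed
  then have "\<phi> ` A \<subseteq> A" by blast
  moreover have "inj_on \<phi> A" using assms(4) lits
    by (auto simp: adm_def k_symmetry_def bij_betw_def intro: inj_on_subset)
  moreover have "finite (lits F)" using finite_vars[OF cnf] by (simp add: lits_def)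
  then have "finite A" using lits finite_subset by blast
  ultimately show ?thesis by (simp add: endo_inj_surj)
qed

end

section \<open>Counting in place of probability\<close>

text \<open>The preimages of \<open>{w \<in> W. P w}\<close> under the four injections cover
  \<open>W\<close>, and none is larger than that set, so \<open>P\<close> holds on at least a
  quarter of \<open>W\<close>.\<close>

lemma four_translates_bound:
  assumes "finite W" "\<And>h. h \<in> {h1, h2, h3, h4} \<Longrightarrow> inj_on h W \<and> h ` W \<subseteq> W"
    and "\<And>w. w \<in> W \<Longrightarrow> \<exists>h\<in>{h1, h2, h3, h4}. P (h w)"
  shows "4 * card {w \<in> W. \<not> P w} \<le> 3 * card W"
proof -
  let ?D = "{w \<in> W. P w}"
  have le: "card {w \<in> W. P (h w)} \<le> card ?D" if "h \<in> {h1, h2, h3, h4}" for h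
  proof (rule card_inj_on_le[of h])
    show "inj_on h {w \<in> W. P (h w)}" using assms(2)[OF that] inj_on_subset by fastforce
  qed (use assms that in auto)
  have "W \<subseteq> {w \<in> W. P (h1 w)} \<union> ({w \<in> W. P (h2 w)} \<union> ({w \<in> W. P (h3 w)} \<union> {w \<in> W. P (h4 w)}))"
    using assms(3) by auto
  then have "card W \<le> card ({w \<in> W. P (h1 w)} \<union> ({w \<in> W. P (h2 w)} \<union> ({w \<in> W. P (h3 w)} \<union> {w \<in> W. P (h4 w)})))"
    using assms(1) by (intro card_mono) auto
  also have "\<dots> \<le> card {w \<in> W. P (h1 w)} + (card {w \<in> W. P (h2 w)} + (card {w \<in> W. P (h3 w)} + card {w \<in> W. P (h4 w)}))"
    by (meson add_left_mono card_Un_le order_trans)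
  also have "\<dots> \<le> 4 * card ?D" using le[of h1] le[of h2] le[of h3] le[of h4] by simp
  finally have "card W \<le> 4 * card ?D" .
  moreover have "card W = card ?D + card {w \<in> W. \<not> P w}"
    using assms(1) by (subst card_Un_disjoint[symmetric]) (auto intro: arg_cong[where f = card])
  ultimately show ?thesis by simp
qed

text \<open>Given that the events before \<open>m\<close> fail, event \<open>m\<close> still has
  probability at least 1/4: \<open>f m\<close> and \<open>g m\<close> do not affect the other
  events, so they map the conditioned set into itself.\<close>

lemma independent_events_bound:
  fixes \<Omega> :: "'w set" and n :: nat
  assumes "finite \<Omega>"
    and "\<And>i. i < n \<Longrightarrow> inj_on (f i) \<Omega> \<and> f i ` \<Omega> \<subseteq> \<Omega>" "\<And>i. i < n \<Longrightarrow> inj_on (g i) \<Omega> \<and> g i ` \<Omega> \<subseteq> \<Omega>"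
    and indep: "\<And>i j w. i < n \<Longrightarrow> j < n \<Longrightarrow> i \<noteq> j \<Longrightarrow> w \<in> \<Omega> \<Longrightarrow>
      (P j (f i w) \<longleftrightarrow> P j w) \<and> (P j (g i w) \<longleftrightarrow> P j w)"
    and hit: "\<And>i w. i < n \<Longrightarrow> w \<in> \<Omega> \<Longrightarrow> P i w \<or> P i (f i w) \<or> P i (g i w) \<or> P i (f i (g i w))"
  shows "4 ^ n * card {w \<in> \<Omega>. \<forall>i<n. \<not> P i w} \<le> 3 ^ n * card \<Omega>"
proof -
  have "4 ^ m * card {w \<in> \<Omega>. \<forall>i<m. \<not> P i w} \<le> 3 ^ m * card \<Omega>" if "m \<le> n" for m
    using that
  proof (induction m)
    case (Suc m)
    let ?W = "{w \<in> \<Omega>. \<forall>i<m. \<not> P i w}"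
    have m: "m < n" using Suc.prems by simp
    have fg: "f m w \<in> ?W" "g m w \<in> ?W" if w: "w \<in> ?W" for w
    proof -
      have "f m w \<in> \<Omega>" "g m w \<in> \<Omega>" using w assms(2,3)[OF m] by blast+
      moreover have "\<not> P i (f m w) \<and> \<not> P i (g m w)" if "i < m" for i
        using indep[OF m, of i w] w that m by simp
      ultimately show "f m w \<in> ?W" "g m w \<in> ?W" by simp_all
    qed
    have inj: "inj_on (f m) ?W" "inj_on (g m) ?W"
      using assms(2,3)[OF m] by (auto intro: inj_on_subset)
    have "4 * card {w \<in> ?W. \<not> P m w} \<le> 3 * card ?W"
    proof (rule four_translates_bound[where ?h1.0 = id and ?h2.0 = "f m" and ?h3.0 = "g m" and ?h4.0 = "f m \<circ> g m"])
      show "finite ?W" using assms(1) by simp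
      show "inj_on h ?W \<and> h ` ?W \<subseteq> ?W" if "h \<in> {id, f m, g m, f m \<circ> g m}" for h
      proof -
        have "inj_on (f m \<circ> g m) ?W"
          using inj fg by (intro comp_inj_on) (auto intro: inj_on_subset)
        then show ?thesis using that inj fg by auto
      qed
      show "\<exists>h\<in>{id, f m, g m, f m \<circ> g m}. P m (h w)" if "w \<in> ?W" for w
        using hit[OF m, of w] that by auto
    qed
    moreover have "{w \<in> ?W. \<not> P m w} = {w \<in> \<Omega>. \<forall>i<Suc m. \<not> P i w}"
      by (auto simp: less_Suc_eq)
    ultimately have "4 ^ m * (4 * card {w \<in> \<Omega>. \<forall>i<Suc m. \<not> P i w}) \<le> 4 ^ m * (3 * card ?W)"
      by simp
    also have "\<dots> = 3 * (4 ^ m * card ?W)" by simp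
    also have "\<dots> \<le> 3 * (3 ^ m * card \<Omega>)" using Suc by simp
    finally show ?case by simp
  qed simp
  then show ?thesis by simp
qed

section \<open>The Tseitin formula of a grid\<close>

lemma odd_card_sym_diff:
  assumes "finite A" "finite B"
  shows "odd (card (sym_diff A B)) \<longleftrightarrow> odd (card A) \<noteq> odd (card B)"
proof -
  have "card (sym_diff A B) = card (A - B) + card (B - A)"
    using assms by (intro card_Un_disjoint) auto
  moreover have "card A = card (A - B) + card (A \<inter> B)"
    using assms by (metis card_Diff_subset_Int card_mono finite_Int inf_le1 le_add_diff_inverse2)
  moreover have "card B = card (B - A) + card (A \<inter> B)"
    using assms by (metis card_Diff_subset_Int card_mono finite_Int inf_commute inf_le1 le_add_diff_inverse2)
  ultimately show ?thesis by presburger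
qed

text \<open>The edge \<open>(d, a, k)\<close> joins positions \<open>k\<close> and \<open>k + 1\<close> of the line \<open>a\<close> in direction \<open>d\<close>:
  rows are lines of direction \<open>False\<close>, columns are lines of direction \<open>True\<close>.\<close>

type_synonym edge = "bool \<times> nat \<times> nat"

text \<open>The index of the line of direction \<open>d\<close> through \<open>u\<close>; the
  position of \<open>u\<close> along that line is \<open>crd (\<not> d) u\<close>.\<close>

definition crd :: "bool \<Rightarrow> nat \<times> nat \<Rightarrow> nat" where
  "crd d u = (if d then snd u else fst u)"

text \<open>A proper edge colouring of the grid with four colours.\<close>

definition colour :: "edge \<Rightarrow> nat" where
  "colour = (\<lambda>(d, a, k). (if d then 2 else 0) + k mod 2)"

text \<open>Together with the edge variable itself, the copies make up the weight
  \<open>2 ^ colour e\<close>.\<close>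

definition copies :: "edge \<Rightarrow> nat" where
  "copies e = 2 ^ colour e - 1"

lemma colour_less: "colour e < 4"
  by (cases e) (auto simp: colour_def)

lemma copies_less: "copies e < 8"
proof -
  have "(2::nat) ^ colour e \<le> 2 ^ 3" using colour_less[of e] by (intro power_increasing) auto
  then show ?thesis by (simp add: copies_def)
qed

lemma copies_less_7: "k < copies e \<Longrightarrow> k < 7"
  using copies_less[of e] by simp

datatype gvar = VX edge | VZ edge nat | VY edge nat | VP nat | VA | VB

instance gvar :: countable
  by countable_datatype

abbreviation X :: "edge \<Rightarrow> nat" where "X e \<equiv> to_nat (VX e)"
abbreviation Z :: "edge \<Rightarrow> nat \<Rightarrow> nat" where "Z e k \<equiv> to_nat (VZ e k)"
abbreviation Y :: "edge \<Rightarrow> nat \<Rightarrow> nat" where "Y e k \<equiv> to_nat (VY e k)"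
abbreviation P :: "nat \<Rightarrow> nat" where "P j \<equiv> to_nat (VP j)"
abbreviation TA :: nat where "TA \<equiv> to_nat VA"
abbreviation TB :: nat where "TB \<equiv> to_nat VB"

lemma card_block:
  assumes "finite D" "inj f" "inj (\<lambda>(e, k). g e k)" "\<And>e e' k. f e \<noteq> g e' k"
  shows "card (f ` D \<union> (\<lambda>(e, k). g e k) ` (SIGMA e:D. {..<copies e})) = (\<Sum>e\<in>D. 2 ^ colour e)"
proof -
  have "card (f ` D \<union> (\<lambda>(e, k). g e k) ` (SIGMA e:D. {..<copies e})) =
      card (f ` D) + card ((\<lambda>(e, k). g e k) ` (SIGMA e:D. {..<copies e}))"
    using assms by (intro card_Un_disjoint) auto
  also have "card (f ` D) = card D"
    using assms(2) by (intro card_image) (auto intro: inj_on_subset)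
  also have "card ((\<lambda>(e, k). g e k) ` (SIGMA e:D. {..<copies e})) = card (SIGMA e:D. {..<copies e})"
    using assms(3) by (intro card_image) (auto intro: inj_on_subset)
  also have "\<dots> = (\<Sum>e\<in>D. copies e)" using assms(1) by (simp add: card_SigmaI)
  also have "card D + (\<Sum>e\<in>D. copies e) = (\<Sum>e\<in>D. 1 + copies e)"
    by (simp only: sum.distrib) simp
  also have "\<dots> = (\<Sum>e\<in>D. 2 ^ colour e)" by (simp add: copies_def)
  finally show ?thesis .
qed

locale grid =
  fixes n :: nat
begin

text \<open>Line \<open>0\<close> and \<open>n\<close> pairs of lines, of which a restriction keeps
  one each.\<close>

definition N :: nat where "N = 2 * n + 1"

definition E :: "edge set" where "E = {(d, a, k). a < N \<and> Suc k < N}"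

definition V :: "(nat \<times> nat) set" where "V = {..<N} \<times> {..<N}"

definition inc :: "nat \<times> nat \<Rightarrow> edge set" where
  "inc u = {(d, a, k) \<in> E. crd d u = a \<and> (crd (\<not> d) u = k \<or> crd (\<not> d) u = Suc k)}"

definition par :: "nat \<times> nat \<Rightarrow> edge set \<Rightarrow> bool" where
  "par u B \<longleftrightarrow> odd (card (inc u \<inter> B))"

text \<open>The path between positions \<open>p\<close> and \<open>q\<close> in either order;
  toggling it moves a parity violation from one end to the other.\<close>

definition seg :: "bool \<Rightarrow> nat \<Rightarrow> nat \<Rightarrow> nat \<Rightarrow> edge set" where
  "seg d a p q = (\<lambda>k. (d, a, k)) ` {min p q..<max p q}"

definition face :: "bool \<Rightarrow> nat \<Rightarrow> nat \<Rightarrow> edge set" where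
  "face d a k = {(d, a, k), (d, Suc a, k), (\<not> d, k, a), (\<not> d, Suc k, a)}"

lemma E_iff: "(d, a, k) \<in> E \<longleftrightarrow> a < N \<and> Suc k < N"
  by (simp add: E_def)

lemma V_iff: "u \<in> V \<longleftrightarrow> (\<forall>d. crd d u < N)"
  by (cases u) (auto simp: V_def crd_def)

lemma E_subset: "E \<subseteq> UNIV \<times> {..<N} \<times> {..<N}"
  by (auto simp: E_def)

lemma finite_E: "finite E"
  using E_subset by (rule finite_subset) simp

lemma card_E: "card E \<le> 2 * N ^ 2"
proof -
  have "card E \<le> card ((UNIV :: bool set) \<times> {..<N} \<times> {..<N})"
    by (intro card_mono E_subset) simp
  then show ?thesis by (simp add: card_cartesian_product power2_eq_square)
qed

lemma finite_V: "finite V"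
  by (simp add: V_def)

lemma card_V: "card V = N ^ 2"
  by (simp add: V_def power2_eq_square)

lemma inc_subset: "inc u \<subseteq> E"
  by (auto simp: inc_def)

lemma finite_inc: "finite (inc u)"
  using finite_E inc_subset finite_subset by blast

lemma inc_iff:
  "(d, a, k) \<in> inc u \<longleftrightarrow> (d, a, k) \<in> E \<and> crd d u = a \<and> (crd (\<not> d) u = k \<or> crd (\<not> d) u = Suc k)"
  by (simp add: inc_def)

lemma par_sym_diff: "par u (sym_diff B C) \<longleftrightarrow> par u B \<noteq> par u C"
proof -
  have "inc u \<inter> sym_diff B C = sym_diff (inc u \<inter> B) (inc u \<inter> C)" by blast
  then show ?thesis
    unfolding par_def using odd_card_sym_diff[of "inc u \<inter> B" "inc u \<inter> C"] finite_inc by simp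
qed

lemma par_empty: "\<not> par u {}"
  by (simp add: par_def)

lemma par_single:
  assumes "(d, a, k) \<in> E"
  shows "par u {(d, a, k)} \<longleftrightarrow> crd d u = a \<and> (crd (\<not> d) u = k \<or> crd (\<not> d) u = Suc k)"
proof (cases "(d, a, k) \<in> inc u")
  case True
  then have "inc u \<inter> {(d, a, k)} = {(d, a, k)}" by blast
  then show ?thesis using True by (simp add: par_def inc_iff)
next
  case False
  then have "inc u \<inter> {(d, a, k)} = {}" by blast
  then show ?thesis using False assms by (simp add: par_def inc_iff)
qed

text \<open>An inner vertex meets two edges of the segment, an end only one, and the two ends cancel
  if they coincide.\<close>

lemma par_seg:
  assumes "a < N" "p < N" "q < N"
  shows "par u (seg d a p q) \<longleftrightarrow> crd d u = a \<and> (crd (\<not> d) u = p) \<noteq> (crd (\<not> d) u = q)"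
proof -
  have *: "par u (seg d a p q) \<longleftrightarrow> crd d u = a \<and> (crd (\<not> d) u = p) \<noteq> (crd (\<not> d) u = q)"
    if "p \<le> q" "q < N" for p q
    using that
  proof (induction q rule: dec_induct)
    case base
    then show ?case by (simp add: seg_def par_empty)
  next
    case (step q)
    have "{p..<Suc q} = insert q {p..<q}" using step.hyps(1) by (simp add: atLeastLessThanSuc)
    then have "seg d a p (Suc q) = insert (d, a, q) (seg d a p q)"
      using step.hyps(1) by (simp add: seg_def min_def max_def)
    moreover have "(d, a, q) \<notin> seg d a p q"
      using step.hyps(1) by (auto simp: seg_def)
    ultimately have "seg d a p (Suc q) = sym_diff (seg d a p q) {(d, a, q)}" by auto
    moreover have "(d, a, q) \<in> E" using step.prems assms(1) by (simp add: E_iff)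
    ultimately have "par u (seg d a p (Suc q)) \<longleftrightarrow>
        (crd d u = a \<and> (crd (\<not> d) u = p) \<noteq> (crd (\<not> d) u = q)) \<noteq>
        (crd d u = a \<and> (crd (\<not> d) u = q \<or> crd (\<not> d) u = Suc q))"
      using step.IH step.prems by (simp only: par_sym_diff par_single Suc_lessD)
    then show ?case
      using step.hyps(1)
      by (cases "crd d u = a"; cases "crd (\<not> d) u = p"; cases "crd (\<not> d) u = q";
          cases "crd (\<not> d) u = Suc q") simp_all
  qed
  have "seg d a p q = seg d a q p" by (simp add: seg_def min.commute max.commute)
  then show ?thesis using *[of p q] *[of q p] assms by (cases "p \<le> q") auto
qed

lemma face_subset: "Suc a < N \<Longrightarrow> Suc k < N \<Longrightarrow> face d a k \<subseteq> E"
  by (auto simp: face_def E_iff)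

lemma par_face:
  assumes "Suc a < N" "Suc k < N"
  shows "\<not> par u (face d a k)"
proof -
  have "face d a k = sym_diff (sym_diff {(d, a, k)} {(d, Suc a, k)})
      (sym_diff {(\<not> d, k, a)} {(\<not> d, Suc k, a)})"
    by (auto simp: face_def)
  moreover have "(d, a, k) \<in> E" "(d, Suc a, k) \<in> E" "(\<not> d, k, a) \<in> E" "(\<not> d, Suc k, a) \<in> E"
    using assms by (auto simp: E_iff)
  ultimately have "par u (face d a k) \<longleftrightarrow>
      ((crd d u = a \<and> (crd (\<not> d) u = k \<or> crd (\<not> d) u = Suc k)) \<noteq>
       (crd d u = Suc a \<and> (crd (\<not> d) u = k \<or> crd (\<not> d) u = Suc k))) \<noteq>
      ((crd (\<not> d) u = k \<and> (crd d u = a \<or> crd d u = Suc a)) \<noteq>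
       (crd (\<not> d) u = Suc k \<and> (crd d u = a \<or> crd d u = Suc a)))"
    by (simp only: par_sym_diff par_single not_not)
  then show ?thesis
    by (cases "crd d u = a"; cases "crd d u = Suc a"; cases "crd (\<not> d) u = k";
        cases "crd (\<not> d) u = Suc k") simp_all
qed

text \<open>Two edges of the same direction at \<open>u\<close> lie on the same line at consecutive
  positions, whose parities differ.\<close>

lemma colour_inj: "inj_on colour (inc u)"
proof (rule inj_onI)
  fix e e' assume e: "e \<in> inc u" "e' \<in> inc u" and c: "colour e = colour e'"
  obtain d a k d' a' k' where [simp]: "e = (d, a, k)" "e' = (d', a', k')"
    by (metis prod_cases3)
  have par2: "k mod 2 < 2" "k' mod 2 < 2" by simp_all
  have "d = d'" using c par2 by (auto simp: colour_def split: if_splits)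
  moreover from this have "k mod 2 = k' mod 2" using c by (simp add: colour_def)
  moreover from calculation have "a = a'" "(k = k' \<or> k = Suc k' \<or> k' = Suc k)" using e by (auto simp: inc_iff)
  ultimately show "e = e'" by (auto simp: mod_Suc split: if_splits)
qed

section \<open>Padding and the clauses of the formula\<close>

text \<open>One identifier per vertex and per copy of an edge: an edge has at most 7 copies, so the
  last component \<open>7\<close> is free to mark vertices.\<close>

definition ids :: "(bool \<times> nat \<times> nat \<times> nat) set" where
  "ids = UNIV \<times> {..<N} \<times> {..<N} \<times> {..<8}"

definition idn :: "bool \<times> nat \<times> nat \<times> nat \<Rightarrow> nat" where
  "idn = (SOME f. bij_betw f ids {..<16 * N ^ 2})"

lemma idn_bij: "bij_betw idn ids {..<16 * N ^ 2}"
proof -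
  have "card ids = card {..<16 * N ^ 2}" "finite ids"
    by (simp_all add: ids_def card_cartesian_product power2_eq_square)
  then have "\<exists>f. bij_betw f ids {..<16 * N ^ 2}" by (intro finite_same_card_bij) auto
  then show ?thesis unfolding idn_def by (rule someI_ex)
qed

lemma idn_inj: "i \<in> ids \<Longrightarrow> j \<in> ids \<Longrightarrow> idn i = idn j \<Longrightarrow> i = j"
  using idn_bij by (meson bij_betw_imp_inj_on inj_onD)

lemma idn_less: "i \<in> ids \<Longrightarrow> idn i < 16 * N ^ 2"
  using idn_bij by (auto simp: bij_betw_def)

text \<open>As \<open>idn\<close> stays below \<open>16 * N ^ 2\<close>, every pad uses only
  variables \<open>P j\<close> with \<open>j < M\<close>, and these are the ones that the chain
  clauses force to be false.\<close>

definition M :: nat where "M = 512 * N ^ 2 + 1"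

definition vid :: "nat \<times> nat \<Rightarrow> bool \<times> nat \<times> nat \<times> nat" where
  "vid u = (False, fst u, snd u, 7)"

definition eid :: "edge \<Rightarrow> nat \<Rightarrow> bool \<times> nat \<times> nat \<times> nat" where
  "eid e k = (fst e, fst (snd e), snd (snd e), k)"

lemma vid_in: "u \<in> V \<Longrightarrow> vid u \<in> ids"
  by (auto simp: vid_def V_def ids_def)

lemma eid_in: "e \<in> E \<Longrightarrow> k < copies e \<Longrightarrow> eid e k \<in> ids"
  using copies_less[of e] by (auto simp: eid_def E_def ids_def)

lemma vid_neq_eid: "k < copies e \<Longrightarrow> vid u \<noteq> eid e k"
  using copies_less_7[of k e] by (auto simp: vid_def eid_def)

lemma vid_eq_iff: "vid u = vid u' \<longleftrightarrow> u = u'"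
  by (cases u; cases u') (simp add: vid_def)

lemma eid_eq_iff: "eid e k = eid e' k' \<longleftrightarrow> e = e' \<and> k = k'"
  by (cases e; cases e') (auto simp: eid_def)

lemma idn_le_M: "i \<in> ids \<Longrightarrow> 32 * idn i < M"
  using idn_less[of i] by (simp add: M_def)

text \<open>Steps of 32 leave room for the weight of a vertex. The two negative literals keep padded
  clauses apart from the chain clauses, which have one, and from the two clauses that force
  \<open>TA\<close> and \<open>TB\<close>, which have none.\<close>

definition pad :: "bool \<times> nat \<times> nat \<times> nat \<Rightarrow> nat clause" where
  "pad i = (\<lambda>j. Pos (P j)) ` {..<32 * idn i} \<union> {Neg TA, Neg TB}"

text \<open>Plain units \<open>{Neg (P j)}\<close> would all have the same signature; the positive
  tail makes the lengths distinct, and the units are recovered from the largest index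
  downwards.\<close>

definition chain :: "nat \<Rightarrow> nat clause" where
  "chain j = insert (Neg (P j)) ((\<lambda>i. Pos (P i)) ` {j<..<M})"

text \<open>\<open>zunit e k\<close> and \<open>yunit e k\<close> share one pad, so flipping
  \<open>e\<close> exchanges them, while their numbers of negative literals, 3 and 2, tell them
  apart.\<close>

definition zunit :: "edge \<Rightarrow> nat \<Rightarrow> nat clause" where
  "zunit e k = insert (Neg (Z e k)) (pad (eid e k))"

definition yunit :: "edge \<Rightarrow> nat \<Rightarrow> nat clause" where
  "yunit e k = insert (Pos (Y e k)) (pad (eid e k))"

definition xcl :: "nat \<times> nat \<Rightarrow> edge set \<Rightarrow> nat clause" where
  "xcl u T = (\<lambda>e. Pos (X e)) ` (inc u - T) \<union> (\<lambda>e. Neg (X e)) ` (inc u \<inter> T)"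

definition wcl :: "nat \<times> nat \<Rightarrow> edge set \<Rightarrow> nat clause" where
  "wcl u T = (\<lambda>(e, k). Pos (Z e k)) ` (SIGMA e:inc u - T. {..<copies e}) \<union>
     (\<lambda>(e, k). Neg (Y e k)) ` (SIGMA e:inc u \<inter> T. {..<copies e})"

definition vcl :: "nat \<times> nat \<Rightarrow> edge set \<Rightarrow> nat clause" where
  "vcl u T = xcl u T \<union> wcl u T \<union> pad (vid u)"

text \<open>The Tseitin formula of the grid with the single odd charge at \<open>(0, 0)\<close>: the clause
  \<^term>\<open>vcl u T\<close> excludes the assignment in which \<^term>\<open>T\<close> is the set of true edges at \<^term>\<open>u\<close>.
  The variables \<open>Z\<close>, \<open>P\<close> are forced to be false, \<open>Y\<close>, \<open>TA\<close>, \<open>TB\<close> to be true. Flipping an edge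
  exchanges \<open>Z\<close> with the negation of \<open>Y\<close>, so \<^const>\<open>wcl\<close> makes the numbers of positive literals
  of the clauses at one vertex distinct, and \<^const>\<open>pad\<close> separates the clauses of different vertices.\<close>

definition tseitin :: "nat cnf" where
  "tseitin = {{Pos TA}, {Pos TB, Pos (P 0)}} \<union> chain ` {..<M} \<union>
     (\<lambda>(e, k). zunit e k) ` (SIGMA e:E. {..<copies e}) \<union>
     (\<lambda>(e, k). yunit e k) ` (SIGMA e:E. {..<copies e}) \<union>
     {vcl u T | u T. u \<in> V \<and> T \<subseteq> inc u \<and> odd (card T) \<noteq> (u = (0, 0))}"

lemma tseitin_cases [consumes 1, case_names TA TB chain zunit yunit vcl]:
  assumes "C \<in> tseitin"
  obtains "C = {Pos TA}" | "C = {Pos TB, Pos (P 0)}" | j where "j < M" "C = chain j"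
  | e k where "e \<in> E" "k < copies e" "C = zunit e k"
  | e k where "e \<in> E" "k < copies e" "C = yunit e k"
  | u T where "u \<in> V" "T \<subseteq> inc u" "odd (card T) \<noteq> (u = (0, 0))" "C = vcl u T"
  using assms unfolding tseitin_def by blast

lemma tseitin_intros:
  "{Pos TA} \<in> tseitin" "{Pos TB, Pos (P 0)} \<in> tseitin"
  "j < M \<Longrightarrow> chain j \<in> tseitin"
  "e \<in> E \<Longrightarrow> k < copies e \<Longrightarrow> zunit e k \<in> tseitin"
  "e \<in> E \<Longrightarrow> k < copies e \<Longrightarrow> yunit e k \<in> tseitin"
  "u \<in> V \<Longrightarrow> T \<subseteq> inc u \<Longrightarrow> odd (card T) \<noteq> (u = (0, 0)) \<Longrightarrow> vcl u T \<in> tseitin"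
  unfolding tseitin_def by blast+

lemma finite_pad: "finite (pad i)"
  by (simp add: pad_def)

lemma finite_wcl: "finite (wcl u T)"
  using finite_inc by (simp add: wcl_def)

lemma finite_xcl: "finite (xcl u T)"
  using finite_inc by (simp add: xcl_def)

lemma finite_clause:
  assumes "C \<in> tseitin"
  shows "finite C"
  using assms
  by (cases rule: tseitin_cases)
    (simp_all add: chain_def zunit_def yunit_def vcl_def finite_pad finite_wcl finite_xcl)

lemma is_cnf_tseitin: "is_cnf tseitin"
proof -
  have "{vcl u T | u T. u \<in> V \<and> T \<subseteq> inc u \<and> odd (card T) \<noteq> (u = (0, 0))} \<subseteq>
      (\<lambda>(u, T). vcl u T) ` (V \<times> Pow E)"
    using inc_subset by fast
  then have "finite {vcl u T | u T. u \<in> V \<and> T \<subseteq> inc u \<and> odd (card T) \<noteq> (u = (0, 0))}"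
    by (rule finite_subset) (simp add: finite_V finite_E)
  then have "finite tseitin"
    using finite_E by (simp add: tseitin_def)
  then show ?thesis using finite_clause by (simp add: is_cnf_def)
qed

section \<open>Signatures are pairwise distinct\<close>

lemma signature_simps:
  "signature {Pos TA} = (1, 0)"
  "signature {Pos TB, Pos (P 0)} = (2, 0)"
  "signature (chain j) = (M - Suc j, 1)"
  "signature (zunit e k) = (32 * idn (eid e k), 3)"
  "signature (yunit e k) = (32 * idn (eid e k) + 1, 2)"
proof -
  have P: "card (P ` A) = card A" for A by (intro card_image) (simp add: inj_on_def)
  show "signature {Pos TA} = (1, 0)" by (simp add: signature_def)
  have "{x. Pos x \<in> {Pos TB, Pos (P 0)}} = {TB, P 0}" by auto
  then show "signature {Pos TB, Pos (P 0)} = (2, 0)" by (simp add: signature_def)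
  have "{x. Pos x \<in> chain j} = P ` {j<..<M}" "{x. Neg x \<in> chain j} = {P j}"
    by (auto simp: chain_def)
  then show "signature (chain j) = (M - Suc j, 1)" by (simp add: signature_def P)
  have "{x. Pos x \<in> zunit e k} = P ` {..<32 * idn (eid e k)}"
    "{x. Neg x \<in> zunit e k} = {Z e k, TA, TB}"
    by (auto simp: zunit_def pad_def)
  then show "signature (zunit e k) = (32 * idn (eid e k), 3)" by (simp add: signature_def P)
  have "{x. Pos x \<in> yunit e k} = insert (Y e k) (P ` {..<32 * idn (eid e k)})"
    "{x. Neg x \<in> yunit e k} = {TA, TB}"
    by (auto simp: yunit_def pad_def)
  moreover have "Y e k \<notin> P ` {..<32 * idn (eid e k)}" by auto
  ultimately show "signature (yunit e k) = (32 * idn (eid e k) + 1, 2)" by (simp add: signature_def P)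
qed

lemma signature_vcl:
  assumes "T \<subseteq> inc u"
  shows "signature (vcl u T) =
    ((\<Sum>e\<in>inc u - T. 2 ^ colour e) + 32 * idn (vid u), (\<Sum>e\<in>T. 2 ^ colour e) + 2)"
proof -
  have fin: "finite (inc u - T)" "finite T" using finite_inc assms finite_subset by blast+
  have "{x. Pos x \<in> vcl u T} =
      (X ` (inc u - T) \<union> (\<lambda>(e, k). Z e k) ` (SIGMA e:inc u - T. {..<copies e})) \<union> P ` {..<32 * idn (vid u)}"
    by (auto simp: vcl_def xcl_def wcl_def pad_def)
  moreover have "card ((X ` (inc u - T) \<union> (\<lambda>(e, k). Z e k) ` (SIGMA e:inc u - T. {..<copies e})) \<union>
      P ` {..<32 * idn (vid u)}) =
    card (X ` (inc u - T) \<union> (\<lambda>(e, k). Z e k) ` (SIGMA e:inc u - T. {..<copies e})) +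
    card (P ` {..<32 * idn (vid u)})"
    using fin by (intro card_Un_disjoint) auto
  moreover have "card (P ` {..<32 * idn (vid u)}) = 32 * idn (vid u)"
    by (subst card_image) (simp_all add: inj_on_def)
  moreover have "card (X ` (inc u - T) \<union> (\<lambda>(e, k). Z e k) ` (SIGMA e:inc u - T. {..<copies e})) =
      (\<Sum>e\<in>inc u - T. 2 ^ colour e)"
    using fin by (intro card_block) (auto simp: inj_def)
  moreover have "{x. Neg x \<in> vcl u T} =
      (X ` T \<union> (\<lambda>(e, k). Y e k) ` (SIGMA e:T. {..<copies e})) \<union> {TA, TB}"
    using assms by (auto simp: vcl_def xcl_def wcl_def pad_def)
  moreover have "card ((X ` T \<union> (\<lambda>(e, k). Y e k) ` (SIGMA e:T. {..<copies e})) \<union> {TA, TB}) =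
      card (X ` T \<union> (\<lambda>(e, k). Y e k) ` (SIGMA e:T. {..<copies e})) + card {TA, TB}"
    using fin by (intro card_Un_disjoint) auto
  moreover have "card (X ` T \<union> (\<lambda>(e, k). Y e k) ` (SIGMA e:T. {..<copies e})) = (\<Sum>e\<in>T. 2 ^ colour e)"
    using fin by (intro card_block) (auto simp: inj_def)
  ultimately show ?thesis by (simp add: signature_def)
qed

text \<open>The colours at one vertex are distinct, so the weight is the binary code of the set of
  colours.\<close>

lemma weight_eq_set_encode: "T \<subseteq> inc u \<Longrightarrow> (\<Sum>e\<in>T. 2 ^ colour e) = set_encode (colour ` T)"
  using colour_inj[of u] by (simp add: set_encode_def sum.reindex inj_on_subset)

lemma weight_inj:
  assumes "T \<subseteq> inc u" "T' \<subseteq> inc u" "(\<Sum>e\<in>T. 2 ^ colour e :: nat) = (\<Sum>e\<in>T'. 2 ^ colour e)"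
  shows "T = T'"
proof -
  have "finite T" "finite T'" using assms finite_inc finite_subset by blast+
  then have "colour ` T = colour ` T'"
    using assms weight_eq_set_encode set_encode_eq[of "colour ` T" "colour ` T'"] by simp
  then show ?thesis using inj_on_image_eq_iff[OF colour_inj assms(1,2)] by simp
qed

lemma weight_less: "(\<Sum>e\<in>inc u. 2 ^ colour e :: nat) < 32"
proof -
  have "set_encode (colour ` inc u) \<le> set_encode {..<4}"
    unfolding set_encode_def using colour_less by (intro sum_mono2) auto
  also have "\<dots> < 32" by (simp add: set_encode_def lessThan_nat_numeral)
  finally show ?thesis using weight_eq_set_encode[of "inc u" u] by simp
qed

text \<open>Without the two literals \<open>Neg TA\<close> and \<open>Neg TB\<close>, the total
  length is \<open>32\<close> times the identifier plus a rest below 32: the weight of all edges at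
  a vertex, or 1 for the clause of an edge copy.\<close>

lemma signature_main:
  assumes "C \<in> tseitin" "snd (signature C) \<ge> 2"
  shows "(\<exists>e k. e \<in> E \<and> k < copies e \<and> (C = zunit e k \<or> C = yunit e k) \<and>
        idn (eid e k) = (fst (signature C) + snd (signature C) - 2) div 32) \<or>
    (\<exists>u T. u \<in> V \<and> T \<subseteq> inc u \<and> C = vcl u T \<and>
        idn (vid u) = (fst (signature C) + snd (signature C) - 2) div 32)"
  using assms(1)
proof (cases rule: tseitin_cases)
  case (vcl u T)
  have "(\<Sum>e\<in>inc u - T. 2 ^ colour e :: nat) + (\<Sum>e\<in>T. 2 ^ colour e) = (\<Sum>e\<in>inc u. 2 ^ colour e)"
    using sum.subset_diff[OF vcl(2) finite_inc, of "\<lambda>e. 2 ^ colour e :: nat"] by simp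
  then have "(fst (signature C) + snd (signature C) - 2) div 32 = idn (vid u)"
    using weight_less[of u] vcl(2,4) by (simp add: signature_vcl)
  then show ?thesis using vcl by metis
next
  case (zunit e k)
  have "idn (eid e k) = (fst (signature C) + snd (signature C) - 2) div 32"
    using zunit(3) by (simp add: signature_simps)
  then show ?thesis using zunit by blast
next
  case (yunit e k)
  have "idn (eid e k) = (fst (signature C) + snd (signature C) - 2) div 32"
    using yunit(3) by (simp add: signature_simps)
  then show ?thesis using yunit by blast
qed (use assms(2) in \<open>simp_all add: signature_simps\<close>)

text \<open>The total length gives the identifier. Below one identifier, the number of negative
  literals separates \<open>zunit\<close> from \<open>yunit\<close>, and for a vertex it is the
  binary code of \<open>T\<close> plus 2.\<close>

lemma signature_inj: "inj_on signature tseitin"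
proof (rule inj_onI)
  fix C D assume CD: "C \<in> tseitin" "D \<in> tseitin" and eq: "signature C = signature D"
  show "C = D"
  proof (cases "snd (signature C) \<ge> 2")
    case False
    \<comment> \<open>With fewer than two negative literals the clause can be read off its
      signature, as \<open>chain j\<close> has \<open>M - Suc j\<close> positive literals.\<close>
    have small: "C = (if snd (signature C) = 1 then chain (M - Suc (fst (signature C)))
        else if fst (signature C) = 1 then {Pos TA} else {Pos TB, Pos (P 0)})"
      if "C \<in> tseitin" "\<not> 2 \<le> snd (signature C)" for C
      using that(1)
    proof (cases rule: tseitin_cases)
      case (vcl u T)
      then show ?thesis using that(2) by (simp add: signature_vcl)
    qed (use that(2) in \<open>simp_all add: signature_simps\<close>)
    have "\<not> 2 \<le> snd (signature D)" using False eq by simp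
    then show ?thesis using small[OF CD(1) False] small[OF CD(2)] eq by metis
  next
    case True
    note C = signature_main[OF CD(1) True] and D = signature_main[OF CD(2)]
    have True': "snd (signature D) \<ge> 2" using True eq by simp
    from C consider (edge) e k where "e \<in> E" "k < copies e" "C = zunit e k \<or> C = yunit e k"
        "idn (eid e k) = (fst (signature C) + snd (signature C) - 2) div 32"
      | (vertex) u T where "u \<in> V" "T \<subseteq> inc u" "C = vcl u T"
        "idn (vid u) = (fst (signature C) + snd (signature C) - 2) div 32" by blast
    then show ?thesis
    proof cases
      case edge
      from D[OF True'] consider (edge') e' k' where "e' \<in> E" "k' < copies e'" "D = zunit e' k' \<or> D = yunit e' k'"
          "idn (eid e' k') = idn (eid e k)"
        | (vertex') u T where "u \<in> V" "T \<subseteq> inc u" "D = vcl u T" "idn (vid u) = idn (eid e k)"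
        using edge(4) eq by metis
      then show ?thesis
      proof cases
        case edge'
        then have "eid e' k' = eid e k" using idn_inj eid_in edge by blast
        then have "e' = e" "k' = k" by (simp_all add: eid_eq_iff)
        then show ?thesis using edge'(3) edge(3) eq by (auto simp: signature_simps)
      next
        case vertex'
        then have "vid u = eid e k" using idn_inj eid_in vid_in edge by blast
        then show ?thesis using vid_neq_eid edge by blast
      qed
    next
      case vertex
      from D[OF True'] consider (edge') e' k' where "e' \<in> E" "k' < copies e'" "D = zunit e' k' \<or> D = yunit e' k'"
          "idn (eid e' k') = idn (vid u)"
        | (vertex') u' T' where "u' \<in> V" "T' \<subseteq> inc u'" "D = vcl u' T'" "idn (vid u') = idn (vid u)"
        using vertex(4) eq by metis
      then show ?thesis
      proof cases
        case edge'
        then have "eid e' k' = vid u" using idn_inj eid_in vid_in vertex by blast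
        then show ?thesis using vid_neq_eid[OF edge'(2)] by metis
      next
        case vertex'
        then have "vid u' = vid u" using idn_inj vid_in vertex by blast
        then have [simp]: "u' = u" by (simp add: vid_eq_iff)
        have "(\<Sum>e\<in>T. 2 ^ colour e :: nat) = (\<Sum>e\<in>T'. 2 ^ colour e)"
          using eq signature_vcl[OF vertex(2)] signature_vcl[OF vertex'(2)] vertex(3) vertex'(3)
          by (metis add_right_cancel snd_conv)
        then have "T = T'" using weight_inj[of T u T'] vertex(2) vertex'(2) by simp
        then show ?thesis using vertex(3) vertex'(3) by simp
      qed
    qed
  qed
qed

sublocale distinct_signatures tseitin
proof
  show "is_cnf tseitin" by (rule is_cnf_tseitin)
  show "inj_on signature tseitin" by (rule signature_inj)
qed

end

section \<open>The lower bound for SR-II\<close>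

context grid
begin

text \<open>The auxiliary variables take their forced values, so among the inputs only vertex
  clauses can be falsified.\<close>

definition asg :: "edge set \<Rightarrow> nat \<Rightarrow> bool" where
  "asg B x \<longleftrightarrow> x \<in> X ` B \<or> x \<in> range (\<lambda>(e, k). Y e k) \<or> x = TA \<or> x = TB"

lemma asg_simps [simp]:
  "asg B (X e) \<longleftrightarrow> e \<in> B" "\<not> asg B (Z e k)" "asg B (Y e k)" "\<not> asg B (P j)" "asg B TA" "asg B TB"
  by (auto simp: asg_def)

lemma asg_cong: "x \<notin> X ` sym_diff B B' \<Longrightarrow> asg B x \<longleftrightarrow> asg B' x"
  by (auto simp: asg_def)

lemma falsified_asg_cong:
  assumes "falsified (asg B) K" "\<And>e. e \<in> sym_diff B B' \<Longrightarrow> X e \<notin> var_of ` K"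
  shows "falsified (asg B') K"
  unfolding falsified_def
proof
  fix l assume l: "l \<in> K"
  have "var_of l \<notin> X ` sym_diff B B'"
  proof
    assume "var_of l \<in> X ` sym_diff B B'"
    then obtain e where "var_of l = X e" "e \<in> sym_diff B B'" by (rule imageE)
    then show False using assms(2)[of e] imageI[OF l, of var_of] by simp
  qed
  then have "asg B (var_of l) \<longleftrightarrow> asg B' (var_of l)" by (rule asg_cong)
  then have "lit_true (asg B) l \<longleftrightarrow> lit_true (asg B') l" by (cases l) simp_all
  then show "\<not> lit_true (asg B') l" using assms(1) l by (simp add: falsified_def)
qed

lemma falsified_input:
  assumes "C \<in> tseitin" "falsified (asg B) C"
  shows "\<exists>u T. u \<in> V \<and> T = inc u \<inter> B \<and> odd (card T) \<noteq> (u = (0, 0)) \<and> C = vcl u T"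
  using assms(1)
proof (cases rule: tseitin_cases)
  case (vcl u T)
  have f: "\<not> lit_true (asg B) l" if "l \<in> xcl u T" for l
    using assms(2) vcl(4) that by (simp add: falsified_def vcl_def)
  have "e \<notin> B" if "e \<in> inc u - T" for e
    using f[of "Pos (X e)"] that by (simp add: xcl_def)
  moreover have "e \<in> B" if "e \<in> T" for e
    using f[of "Neg (X e)"] that vcl(2) by (auto simp: xcl_def)
  ultimately have "T = inc u \<inter> B" using vcl(2) by blast
  then show ?thesis using vcl by blast
next
  case (chain j)
  then show ?thesis using assms(2) by (simp add: falsified_def chain_def)
next
  case (zunit e k)
  then show ?thesis using assms(2) by (simp add: falsified_def zunit_def)
next
  case (yunit e k)
  then show ?thesis using assms(2) by (simp add: falsified_def yunit_def)
qed (use assms(2) in \<open>simp_all add: falsified_def\<close>)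

section \<open>The adversary and critical clauses\<close>

definition touches :: "nat clause \<Rightarrow> bool \<Rightarrow> nat \<Rightarrow> bool" where
  "touches A d a \<longleftrightarrow> (\<exists>k. Suc k < N \<and> X (d, a, k) \<in> var_of ` A)"

text \<open>A restriction freezes one line of each pair \<open>2i + 1\<close>, \<open>2i + 2\<close> in each direction, as
  selected by \<open>L\<close>; line \<open>0\<close> always stays live.\<close>

definition live :: "(bool \<times> nat) set \<Rightarrow> bool \<Rightarrow> nat \<Rightarrow> bool" where
  "live L d a \<longleftrightarrow> a = 0 \<or> (odd a \<longleftrightarrow> (d, (a - 1) div 2) \<in> L)"

definition wide :: "(bool \<times> nat) set \<Rightarrow> nat clause \<Rightarrow> bool \<Rightarrow> bool" where
  "wide L A d \<longleftrightarrow> (\<forall>a<N. live L d a \<longrightarrow> touches A d a)"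

definition agrees :: "(bool \<times> nat) set \<Rightarrow> edge set \<Rightarrow> edge set \<Rightarrow> bool" where
  "agrees L B B' \<longleftrightarrow> (\<forall>d a k. \<not> live L d a \<longrightarrow> ((d, a, k) \<in> B' \<longleftrightarrow> (d, a, k) \<in> B))"

definition critical :: "(bool \<times> nat) set \<Rightarrow> edge set \<Rightarrow> nat clause \<Rightarrow> bool \<Rightarrow> bool" where
  "critical L B A d \<longleftrightarrow> wide L A d \<and> (\<exists>B'. agrees L B B' \<and> falsified (asg B') A)"

text \<open>The adversary keeps an assignment falsifying the current clause whose only violated
  vertex \<open>v\<close> is the crossing of two live lines that the clause does not touch.\<close>

definition position :: "(bool \<times> nat) set \<Rightarrow> edge set \<Rightarrow> nat clause \<Rightarrow> edge set \<Rightarrow> nat \<times> nat \<Rightarrow> bool" where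
  "position L B A B' v \<longleftrightarrow> v \<in> V \<and> (\<forall>d. live L d (crd d v) \<and> \<not> touches A d (crd d v)) \<and>
     (\<forall>u\<in>V. par u B' \<longleftrightarrow> (u = v) \<noteq> (u = (0, 0))) \<and> agrees L B B' \<and> falsified (asg B') A"

lemma eq_iff_crd: "u = v \<longleftrightarrow> crd d u = crd d v \<and> crd (\<not> d) u = crd (\<not> d) v"
  by (cases u; cases v; cases d) (auto simp: crd_def)

lemma ex_crd: "\<exists>v. crd d v = a \<and> crd (\<not> d) v = b"
proof (cases d)
  case True
  then show ?thesis by (intro exI[of _ "(b, a)"]) (simp add: crd_def)
next
  case False
  then show ?thesis by (intro exI[of _ "(a, b)"]) (simp add: crd_def)
qed

text \<open>Here \<open>R\<close> is a resolvent on \<open>p\<close> and \<open>K\<close> a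
  falsified parent. \<open>K\<close> has at most the variable \<open>p\<close> in addition, so at
  most one of the two lines through \<open>v\<close> becomes touched. If it has direction
  \<open>d\<close> and some live line of direction \<open>d\<close> is still untouched, the
  violation slides to it along the other line through \<open>v\<close>; this line is live and
  untouched, so frozen values and falsity of \<open>K\<close> are preserved. Otherwise
  \<open>K\<close> is critical.\<close>

lemma position_step:
  assumes pos: "position L B R B' v" and K: "falsified (asg B') K"
    and sub: "\<And>l. l \<in> K \<Longrightarrow> l \<in> R \<or> var_of l = p"
  shows "(\<exists>d. critical L B K d) \<or> (\<exists>B'' v'. position L B K B'' v')"
proof (cases "\<exists>d. touches K d (crd d v)")
  case False
  then have "position L B K B' v" using pos K by (simp add: position_def)
  then show ?thesis by blast
next
  case True
  have pv: "\<exists>k. p = X (d, crd d v, k)" if t: "touches K d (crd d v)" for d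
  proof -
    obtain k l where kl: "Suc k < N" "l \<in> K" "var_of l = X (d, crd d v, k)"
      using t unfolding touches_def by force
    moreover have "\<not> touches R d (crd d v)" using pos unfolding position_def by blast
    then have "l \<notin> R" using kl unfolding touches_def by (metis imageI)
    ultimately show ?thesis using sub by metis
  qed
  from True obtain d where d: "touches K d (crd d v)" by blast
  let ?c = "crd (\<not> d) v"
  \<comment> \<open>The variable \<open>p\<close> belongs to a single edge, which lies on one line
    only.\<close>
  have nt: "\<not> touches K (\<not> d) ?c"
  proof
    assume "touches K (\<not> d) ?c"
    then have "\<exists>k. p = X (\<not> d, ?c, k)" by (rule pv)
    moreover have "\<exists>k. p = X (d, crd d v, k)" using d by (rule pv)
    ultimately show False by auto
  qed
  show ?thesis
  proof (cases "wide L K d")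
    case True
    then show ?thesis using pos K unfolding critical_def position_def by blast
  next
    case False
    then obtain a where a: "a < N" "live L d a" "\<not> touches K d a"
      by (auto simp: wide_def)
    obtain v' where v': "crd d v' = a" "crd (\<not> d) v' = ?c" using ex_crd by blast
    have less: "crd d v < N" "?c < N" using pos by (simp_all add: position_def V_iff)
    define S where "S = seg (\<not> d) ?c (crd d v) a"
    define B'' where "B'' = sym_diff B' S"
    have S: "S \<subseteq> {(\<not> d, ?c, k) | k. Suc k < N}"
      using less a(1) by (auto simp: S_def seg_def max_def split: if_splits)
    have live_c: "live L (\<not> d) ?c" using pos by (simp add: position_def)
    have parS: "par u S \<longleftrightarrow> (u = v) \<noteq> (u = v')" for u
    proof -
      have "par u S \<longleftrightarrow> crd (\<not> d) u = ?c \<and> (crd d u = crd d v) \<noteq> (crd d u = a)"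
        unfolding S_def using par_seg[OF less(2,1) a(1), of u "\<not> d"] by simp
      then show ?thesis
        using eq_iff_crd[of u v d] eq_iff_crd[of u v' d] v' by auto
    qed
    have "position L B K B'' v'"
      unfolding position_def
    proof (intro conjI ballI allI)
      show "v' \<in> V"
      proof -
        have "crd d' v' < N" for d' using v' a(1) less by (cases "d' = d") auto
        then show ?thesis by (simp add: V_iff)
      qed
      fix d'
      have "live L d' (crd d' v') \<and> \<not> touches K d' (crd d' v')"
      proof (cases "d' = d")
        case True
        show ?thesis unfolding True v'(1) using a by blast
      next
        case False
        then have d': "d' = (\<not> d)" by blast
        show ?thesis unfolding d' v'(2) using live_c nt by blast
      qed
      then show "live L d' (crd d' v')" "\<not> touches K d' (crd d' v')" by blast+
    next
      fix u assume "u \<in> V"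
      then have "par u B' \<longleftrightarrow> (u = v) \<noteq> (u = (0, 0))" using pos by (simp add: position_def)
      then show "par u B'' \<longleftrightarrow> (u = v') \<noteq> (u = (0, 0))"
        unfolding B''_def par_sym_diff parS by blast
    next
      have "agrees L B B'" using pos by (simp add: position_def)
      moreover have "live L d' a'" if "(d', a', k) \<in> S" for d' a' k
      proof -
        have "d' = (\<not> d)" "a' = ?c" using S that by blast+
        then show ?thesis using live_c by simp
      qed
      ultimately show "agrees L B B''" unfolding agrees_def B''_def by blast
    next
      show "falsified (asg B'') K"
      proof (rule falsified_asg_cong[OF K])
        fix e assume "e \<in> sym_diff B' B''"
        then have "e \<in> S" by (auto simp: B''_def)
        then obtain k where "e = (\<not> d, ?c, k)" "Suc k < N" using S by blast
        then show "X e \<notin> var_of ` K" using nt by (auto simp: touches_def)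
      qed
    qed
    then show ?thesis by blast
  qed
qed

text \<open>A falsified input is the clause of the violated vertex, and it contains an edge of the
  row through that vertex. Such an edge exists because \<open>n > 0\<close> makes rows longer than
  one vertex.\<close>

lemma position_not_input:
  assumes "n > 0" "C \<in> tseitin"
  shows "\<not> position L B C B' v"
proof
  assume pos: "position L B C B' v"
  then have "falsified (asg B') C" by (simp add: position_def)
  then obtain u T where u: "u \<in> V" "T = inc u \<inter> B'" "odd (card T) \<noteq> (u = (0, 0))" "C = vcl u T"
    using falsified_input[OF assms(2)] by blast
  have "par u B' \<noteq> (u = (0, 0))" using u by (simp add: par_def)
  then have "u = v" using pos u(1) by (auto simp: position_def)
  \<comment> \<open>The last vertex of a row has no edge to its right, so its left one is
    taken.\<close>
  define k where "k = (if Suc (crd True v) < N then crd True v else crd True v - 1)"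
  have v: "crd True v < N" "crd False v < N" using pos by (simp_all add: position_def V_iff)
  then have k: "Suc k < N" "crd True v = k \<or> crd True v = Suc k"
    using assms(1) by (auto simp: k_def N_def)
  then have "(False, crd False v, k) \<in> inc v" using v by (simp add: inc_iff E_iff)
  then have "X (False, crd False v, k) \<in> var_of ` C"
    unfolding mem_var_of_image_iff \<open>C = vcl u T\<close> \<open>u = v\<close> vcl_def xcl_def by blast
  then have "touches C False (crd False v)" using k by (auto simp: touches_def)
  then show False using pos by (simp add: position_def)
qed

text \<open>The adversary walks backwards through the proof. It cannot reach an input, and symmetry
  steps do not change the falsified clause, so at some resolution step it must meet a critical
  parent.\<close>

lemma critical_clause_exists:
  assumes "n > 0" "derivation adm tseitin \<pi>" "(S, A) \<in> set \<pi>" "position L B A B' v"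
  shows "\<exists>A'\<in>snd ` set \<pi>. \<exists>d. critical L B A' d"
  using assms(2-4)
proof (induction arbitrary: S A B' v)
  case empty
  then show ?case by simp
next
  case (input \<pi> C S A B' v)
  then have "(S, A) \<in> set \<pi>" 
    using position_not_input[OF assms(1) input.hyps(2), of L B B' v] by auto
  then have "\<exists>A'\<in>snd ` set \<pi>. \<exists>d. critical L B A' d" using input.IH input.prems(2) by blast
  then show ?case by auto
next
  case (resolution \<pi> S C T D x S' A B' v)
  have "\<exists>A'\<in>snd ` set \<pi>. \<exists>d. critical L B A' d"
  proof (cases "(S', A) \<in> set \<pi>")
    case True
    then show ?thesis using resolution.IH resolution.prems(2) by blast
  next
    case False
    then have A: "A = resolvent x C D" using resolution.prems(1) by simp
    moreover have "falsified (asg B') A" using resolution.prems(2) by (simp add: position_def)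
    ultimately have "falsified (asg B') C \<or> falsified (asg B') D"
      using falsified_resolvent[of "asg B'" x C D] by simp
    then obtain S' K where K: "(S', K) \<in> set \<pi>" "K = C \<or> K = D" "falsified (asg B') K"
      using resolution.hyps(2,3) by blast
    have "l \<in> A \<or> var_of l = x" if "l \<in> K" for l
      using K(2) that unfolding A resolvent_def by (cases l) auto
    from position_step[OF resolution.prems(2) K(3) this]
    consider d where "critical L B K d" | B'' v' where "position L B K B'' v'" by blast
    then show ?thesis
    proof cases
      case 1
      moreover have "K \<in> snd ` set \<pi>" using imageI[OF K(1), of snd] by simp
      ultimately show ?thesis by blast
    next
      case 2
      show ?thesis by (rule resolution.IH[OF K(1) 2])
    qed
  qed
  then show ?case by auto
next
  case (symmetry \<pi> S A K \<phi> S' A' B' v)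
  have "\<exists>A'\<in>snd ` set \<pi>. \<exists>d. critical L B A' d"
  proof (cases "(S', A') \<in> set \<pi>")
    case True
    then show ?thesis using symmetry.IH symmetry.prems(2) by blast
  next
    case False
    then have "A' = \<phi> ` A" using symmetry.prems(1) by simp
    moreover have "falsified (asg B') A'" using symmetry.prems(2) by (simp add: position_def)
    ultimately have "A' = A"
      using symmetry_trivial[OF symmetry.hyps(1-4)] by simp
    then show ?thesis using symmetry.IH[OF symmetry.hyps(2)] symmetry.prems(2) by simp
  qed
  then show ?case by auto
qed

section \<open>The random restriction\<close>

definition cycles :: "edge set set" where
  "cycles = {B. B \<subseteq> E \<and> (\<forall>u. \<not> par u B)}"

text \<open>Values taken from a cycle satisfy every parity condition except the odd charge at
  \<open>(0, 0)\<close>, which is where the adversary starts.\<close>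

definition space :: "((bool \<times> nat) set \<times> edge set) set" where
  "space = Pow (UNIV \<times> {..<n}) \<times> cycles"

lemma finite_cycles: "finite cycles"
proof (rule finite_subset)
  show "cycles \<subseteq> Pow E" by (auto simp: cycles_def)
qed (simp add: finite_E)

lemma finite_space: "finite space"
  by (simp add: space_def finite_cycles)

lemma empty_in_space: "({}, {}) \<in> space"
  by (simp add: space_def cycles_def par_empty)

lemma position_start:
  assumes "(L, B) \<in> space"
  shows "position L B {} B (0, 0)"
  using assms
  by (auto simp: position_def V_def N_def crd_def live_def touches_def space_def cycles_def
      agrees_def falsified_def)

lemma live_pair: "live L d (2 * i + 1) \<longleftrightarrow> (d, i) \<in> L" "live L d (2 * i + 2) \<longleftrightarrow> (d, i) \<notin> L"
  by (simp_all add: live_def)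

text \<open>If \<open>A\<close> misses both lines of a pair, it is never wide, as one of them is
  live. Otherwise each pair offers a literal of \<open>A\<close> on one of its lines, and
  \<open>A\<close> can be critical only if none of these literals is both frozen and true.\<close>

lemma card_critical:
  "4 ^ n * card {w \<in> space. critical (fst w) (snd w) A d} \<le> 3 ^ n * card space"
proof (cases "\<exists>i<n. \<not> touches A d (2 * i + 1) \<and> \<not> touches A d (2 * i + 2)")
  case True
  then obtain i where i: "i < n" "\<not> touches A d (2 * i + 1)" "\<not> touches A d (2 * i + 2)" by blast
  have "\<not> wide L A d" for L
  proof
    assume w: "wide L A d"
    have "2 * i + 1 < N" "2 * i + 2 < N" using i(1) by (simp_all add: N_def)
    then have "\<not> live L d (2 * i + 1)" "\<not> live L d (2 * i + 2)"
      using w i(2,3) unfolding wide_def by blast+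
    then show False using live_pair by blast
  qed
  then show ?thesis by (simp add: critical_def)
next
  case False
  \<comment> \<open>For each pair, \<open>z\<close> packs a touched line, a position on it and a
    literal of \<open>A\<close> over that edge, to be chosen simultaneously.\<close>
  have "\<exists>z. i < n \<longrightarrow> (fst z = 2 * i + 1 \<or> fst z = 2 * i + 2) \<and> Suc (fst (snd z)) < N \<and>
      snd (snd z) \<in> A \<and> var_of (snd (snd z)) = X (d, fst z, fst (snd z))" for i
  proof (cases "i < n")
    case True
    then obtain a where a: "a = 2 * i + 1 \<or> a = 2 * i + 2" "touches A d a" using False by blast
    then obtain k l where "Suc k < N" "l \<in> A" "var_of l = X (d, a, k)"
      unfolding touches_def by force
    then show ?thesis using a by (intro exI[of _ "(a, k, l)"]) simp
  qed simp
  then obtain z where z: "\<And>i. i < n \<Longrightarrow> (fst (z i) = 2 * i + 1 \<or> fst (z i) = 2 * i + 2) \<and>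
      Suc (fst (snd (z i))) < N \<and> snd (snd (z i)) \<in> A \<and>
      var_of (snd (snd (z i))) = X (d, fst (z i), fst (snd (z i)))"
    by metis
  define a k l where "a i = fst (z i)" and "k i = fst (snd (z i))" and "l i = snd (snd (z i))" for i
  have a: "a i = 2 * i + 1 \<or> a i = 2 * i + 2" and k: "Suc (k i) < N" and l: "l i \<in> A"
    and lv: "var_of (l i) = X (d, a i, k i)" if "i < n" for i
    using z[OF that] by (simp_all add: a_def k_def l_def)
  define Q where "Q i w \<longleftrightarrow> \<not> live (fst w) d (a i) \<and> lit_true (asg (snd w)) (l i)"
    for i and w :: "(bool \<times> nat) set \<times> edge set"
  define f where "f i w = (sym_diff (fst w) {(d, i)}, snd w)"
    for i and w :: "(bool \<times> nat) set \<times> edge set"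
  define g where "g i w = (fst w, sym_diff (snd w) (face d (2 * i + 1) (k i)))"
    for i and w :: "(bool \<times> nat) set \<times> edge set"
  have face_less: "Suc (2 * i + 1) < N" if "i < n" for i using that by (simp add: N_def)
  have live_f: "live (sym_diff L {(d, i)}) d (a j) \<longleftrightarrow> live L d (a j) \<noteq> (i = j)" if "j < n" for i j L
    using a[OF that] by (elim disjE) (auto simp only: live_pair)
  have lit: "lit_true (asg (sym_diff B (face d (2 * i + 1) (k i)))) (l j) \<longleftrightarrow>
      lit_true (asg B) (l j) \<noteq> (i = j)" if "i < n" "j < n" for i j B
  proof -
    have "(d, a j, k j) \<in> face d (2 * i + 1) (k i) \<longleftrightarrow> i = j"
    proof
      assume "(d, a j, k j) \<in> face d (2 * i + 1) (k i)"
      then have "a j = 2 * i + 1 \<or> a j = Suc (2 * i + 1)" by (auto simp: face_def)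
      then show "i = j" using a[OF that(2)] by presburger
    next
      assume "i = j"
      then show "(d, a j, k j) \<in> face d (2 * i + 1) (k i)" using a[OF that(2)] by (auto simp: face_def)
    qed
    then show ?thesis using lv[OF that(2)] by (cases "l j") auto
  qed
  have "4 ^ n * card {w \<in> space. \<forall>i<n. \<not> Q i w} \<le> 3 ^ n * card space"
  proof (rule independent_events_bound[where f = f and g = g])
    show "finite space" by (rule finite_space)
    show "inj_on (f i) space \<and> f i ` space \<subseteq> space" if "i < n" for i
      using that by (auto simp: inj_on_def f_def space_def)
    show "inj_on (g i) space \<and> g i ` space \<subseteq> space" if i: "i < n" for i
    proof
      show "inj_on (g i) space" by (auto simp: inj_on_def g_def)
      have "sym_diff B (face d (2 * i + 1) (k i)) \<in> cycles" if "B \<in> cycles" for B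
        using that par_face[OF face_less[OF i] k[OF i]] face_subset[OF face_less[OF i] k[OF i]]
        unfolding cycles_def mem_Collect_eq par_sym_diff by blast
      then show "g i ` space \<subseteq> space" by (auto simp: g_def space_def simp del: Un_iff)
    qed
    show "(Q j (f i w) \<longleftrightarrow> Q j w) \<and> (Q j (g i w) \<longleftrightarrow> Q j w)"
      if "i < n" "j < n" "i \<noteq> j" for i j w
      using live_f[OF that(2)] lit[OF that(1,2)] that(3) by (simp add: Q_def f_def g_def)
    show "Q i w \<or> Q i (f i w) \<or> Q i (g i w) \<or> Q i (f i (g i w))" if "i < n" for i w
      using live_f[OF that, of _ i] lit[OF that that] by (simp add: Q_def f_def g_def) blast
  qed
  moreover have "{w \<in> space. critical (fst w) (snd w) A d} \<subseteq> {w \<in> space. \<forall>i<n. \<not> Q i w}"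
  proof (intro subsetI CollectI conjI allI impI)
    fix w i assume w: "w \<in> {w \<in> space. critical (fst w) (snd w) A d}" and i: "i < n"
    then obtain B' where B': "agrees (fst w) (snd w) B'" "falsified (asg B') A"
      by (auto simp: critical_def)
    show "\<not> Q i w"
    proof
      assume Q: "Q i w"
      then have "(d, a i, k i) \<in> B' \<longleftrightarrow> (d, a i, k i) \<in> snd w"
        using B'(1) by (simp add: Q_def agrees_def)
      then have "lit_true (asg B') (l i)" using Q lv[OF i] by (cases "l i") (auto simp: Q_def)
      then show False using B'(2) l[OF i] by (simp add: falsified_def)
    qed
  qed simp
  then have "card {w \<in> space. critical (fst w) (snd w) A d} \<le> card {w \<in> space. \<forall>i<n. \<not> Q i w}"
    using finite_space by (intro card_mono) simp_all
  ultimately show ?thesis by (meson le_trans mult_le_mono2)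
qed

text \<open>Union bound: every restriction has a critical pair of a clause and a direction, and the
  two directions account for the factor 2.\<close>

lemma SR_II_lower_bound:
  assumes "n > 0" "SR_II_proof tseitin \<pi>"
  shows "4 ^ n \<le> 2 * length \<pi> * 3 ^ n"
proof -
  have \<pi>: "derivation adm tseitin \<pi>" "\<pi> \<noteq> []" "snd (last \<pi>) = {}"
    using assms(2) by (simp_all add: SR_II_proof_iff refutation_def)
  have last: "(fst (last \<pi>), {}) \<in> set \<pi>" using last_in_set[OF \<pi>(2)] \<pi>(3) by (metis prod.collapse)
  let ?C = "\<lambda>(A, d). {w \<in> space. critical (fst w) (snd w) A d}"
  let ?I = "snd ` set \<pi> \<times> (UNIV :: bool set)"
  have "space \<subseteq> (\<Union>i\<in>?I. ?C i)"
  proof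
    fix w assume w: "w \<in> space"
    obtain L B where [simp]: "w = (L, B)" by (cases w)
    have "position L B {} B (0, 0)" using position_start w by simp
    from critical_clause_exists[OF assms(1) \<pi>(1) last this]
    obtain A d where "A \<in> snd ` set \<pi>" "critical L B A d" by blast
    then show "w \<in> (\<Union>i\<in>?I. ?C i)" using w by (intro UN_I[of "(A, d)"]) simp_all
  qed
  then have "card space \<le> card (\<Union>i\<in>?I. ?C i)"
    using finite_space by (intro card_mono) auto
  also have "\<dots> \<le> (\<Sum>i\<in>?I. card (?C i))" by (rule card_UN_le) simp
  finally have "4 ^ n * card space \<le> 4 ^ n * (\<Sum>i\<in>?I. card (?C i))" by simp
  also have "\<dots> = (\<Sum>i\<in>?I. 4 ^ n * card (?C i))" by (rule sum_distrib_left)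
  also have "\<dots> \<le> (\<Sum>i\<in>?I. 3 ^ n * card space)"
    using card_critical by (intro sum_mono) auto
  also have "\<dots> = card (snd ` set \<pi>) * 2 * (3 ^ n * card space)"
    by (simp add: card_cartesian_product)
  also have "\<dots> \<le> length \<pi> * 2 * (3 ^ n * card space)"
    by (intro mult_right_mono) (meson card_image_le card_length finite_set le_trans, simp_all)
  finally have "4 ^ n * card space \<le> (2 * length \<pi> * 3 ^ n) * card space" by (simp add: ac_simps)
  moreover have "card space > 0" using empty_in_space finite_space by (auto simp: card_gt_0_iff)
  ultimately show ?thesis by simp
qed

end

section \<open>The short proof with global symmetries\<close>

context grid
begin

section \<open>Face flips are symmetries\<close>

definition flip_var :: "edge set \<Rightarrow> nat \<Rightarrow> nat lit" where
  "flip_var \<Phi> x = (case from_nat x of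
     VX e \<Rightarrow> if e \<in> \<Phi> then Neg x else Pos x
   | VZ e k \<Rightarrow> if e \<in> \<Phi> then Neg (Y e k) else Pos x
   | VY e k \<Rightarrow> if e \<in> \<Phi> then Neg (Z e k) else Pos x
   | _ \<Rightarrow> Pos x)"

definition flip :: "edge set \<Rightarrow> nat lit \<Rightarrow> nat lit" where
  "flip \<Phi> l = (case l of Pos x \<Rightarrow> flip_var \<Phi> x | Neg x \<Rightarrow> negate (flip_var \<Phi> x))"

lemma flip_simps [simp]:
  "flip \<Phi> (Pos (X e)) = (if e \<in> \<Phi> then Neg (X e) else Pos (X e))"
  "flip \<Phi> (Neg (X e)) = (if e \<in> \<Phi> then Pos (X e) else Neg (X e))"
  "flip \<Phi> (Pos (Z e k)) = (if e \<in> \<Phi> then Neg (Y e k) else Pos (Z e k))"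
  "flip \<Phi> (Neg (Z e k)) = (if e \<in> \<Phi> then Pos (Y e k) else Neg (Z e k))"
  "flip \<Phi> (Pos (Y e k)) = (if e \<in> \<Phi> then Neg (Z e k) else Pos (Y e k))"
  "flip \<Phi> (Neg (Y e k)) = (if e \<in> \<Phi> then Pos (Z e k) else Neg (Y e k))"
  "flip \<Phi> (Pos (P j)) = Pos (P j)" "flip \<Phi> (Neg (P j)) = Neg (P j)"
  "flip \<Phi> (Pos TA) = Pos TA" "flip \<Phi> (Neg TA) = Neg TA"
  "flip \<Phi> (Pos TB) = Pos TB" "flip \<Phi> (Neg TB) = Neg TB"
  by (simp_all add: flip_def flip_var_def)

lemma flip_negate: "flip \<Phi> (negate l) = negate (flip \<Phi> l)"
  by (cases l) (simp_all add: flip_def)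

text \<open>The restriction to codes is due to \<open>from_nat\<close>, which inverts
  \<open>to_nat\<close> only on its range.\<close>

lemma flip_flip: "var_of l \<in> range (to_nat :: gvar \<Rightarrow> nat) \<Longrightarrow> flip \<Phi> (flip \<Phi> l) = l"
proof -
  assume "var_of l \<in> range (to_nat :: gvar \<Rightarrow> nat)"
  then obtain g :: gvar where g: "var_of l = to_nat g" by blast
  show ?thesis
  proof (cases l)
    case (Pos x)
    then show ?thesis using g by (cases g) auto
  next
    case (Neg x)
    then show ?thesis using g by (cases g) auto
  qed
qed

lemma flip_pad: "flip \<Phi> ` pad i = pad i"
  by (simp add: pad_def image_Un image_image)

lemma flip_xcl: "flip \<Phi> ` xcl u T = xcl u (sym_diff T (inc u \<inter> \<Phi>))"
proof -
  have "flip \<Phi> ` xcl u T = (\<lambda>e. flip \<Phi> (if e \<in> T then Neg (X e) else Pos (X e))) ` inc u"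
    unfolding xcl_def by force
  also have "\<dots> = (\<lambda>e. if e \<in> sym_diff T (inc u \<inter> \<Phi>) then Neg (X e) else Pos (X e)) ` inc u"
    by (intro image_cong) auto
  also have "\<dots> = xcl u (sym_diff T (inc u \<inter> \<Phi>))"
    unfolding xcl_def by force
  finally show ?thesis .
qed

lemma flip_wcl: "flip \<Phi> ` wcl u T = wcl u (sym_diff T (inc u \<inter> \<Phi>))"
proof -
  have wcl: "wcl u S = (\<lambda>(e, k). if e \<in> S then Neg (Y e k) else Pos (Z e k)) ` (SIGMA e:inc u. {..<copies e})" for S
    unfolding wcl_def by force
  have "flip \<Phi> ` wcl u T = (\<lambda>(e, k). flip \<Phi> (if e \<in> T then Neg (Y e k) else Pos (Z e k))) ` (SIGMA e:inc u. {..<copies e})"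
    unfolding wcl image_image by (intro image_cong) auto
  also have "\<dots> = wcl u (sym_diff T (inc u \<inter> \<Phi>))"
    unfolding wcl by (intro image_cong) auto
  finally show ?thesis .
qed

text \<open>\<open>\<Phi>\<close> meets every vertex in an even number of edges, so the parity of
  the excluded set \<open>T\<close> is preserved. The unit clauses of the copies are exchanged in
  pairs, and all others are fixed.\<close>

lemma flip_clause:
  assumes "\<And>u. \<not> par u \<Phi>" "C \<in> tseitin"
  shows "flip \<Phi> ` C \<in> tseitin"
  using assms(2)
proof (cases rule: tseitin_cases)
  case (chain j)
  then have "flip \<Phi> ` C = C" by (simp add: chain_def image_image)
  then show ?thesis using assms(2) by simp
next
  case (zunit e k)
  then have "flip \<Phi> ` C = (if e \<in> \<Phi> then yunit e k else zunit e k)"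
    by (simp add: zunit_def yunit_def flip_pad)
  then show ?thesis using zunit tseitin_intros by simp
next
  case (yunit e k)
  then have "flip \<Phi> ` C = (if e \<in> \<Phi> then zunit e k else yunit e k)"
    by (simp add: zunit_def yunit_def flip_pad)
  then show ?thesis using yunit tseitin_intros by simp
next
  case (vcl u T)
  let ?T = "sym_diff T (inc u \<inter> \<Phi>)"
  have "flip \<Phi> ` C = vcl u ?T"
    using vcl(4) unfolding vcl_def by (simp only: image_Un flip_xcl flip_wcl flip_pad)
  moreover have "odd (card ?T) \<longleftrightarrow> odd (card T)"
    using odd_card_sym_diff[of T "inc u \<inter> \<Phi>"] assms(1)[of u] vcl(2) finite_inc[of u]
    by (auto simp: par_def dest: finite_subset)
  moreover have "?T \<subseteq> inc u" using vcl(2) by blast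
  ultimately show ?thesis using vcl(1,3) tseitin_intros(6)[of u ?T] by simp
qed (use assms(2) in simp_all)

definition all_vars :: "nat set" where
  "all_vars = X ` E \<union> (\<lambda>(e, k). Z e k) ` (E \<times> {..<8}) \<union> (\<lambda>(e, k). Y e k) ` (E \<times> {..<8}) \<union>
     range P \<union> {TA, TB}"

lemma var_of_pad: "l \<in> pad i \<Longrightarrow> var_of l \<in> all_vars"
  by (auto simp: pad_def all_vars_def)

lemma vars_tseitin: "vars tseitin \<subseteq> all_vars"
proof -
  have "var_of l \<in> all_vars" if C: "C \<in> tseitin" and l: "l \<in> C" for C l
    using C
  proof (cases rule: tseitin_cases)
    case (vcl u T)
    consider "l \<in> xcl u T" | "l \<in> wcl u T" | "l \<in> pad (vid u)" using l vcl(4) by (auto simp: vcl_def)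
    then show ?thesis
    proof cases
      case 1
      then obtain e where "e \<in> inc u" "var_of l = X e" by (auto simp: xcl_def)
      then show ?thesis using inc_subset[of u] by (auto simp: all_vars_def)
    next
      case 2
      then obtain e k where e: "e \<in> inc u" "k < copies e" "var_of l = Z e k \<or> var_of l = Y e k"
        by (auto simp: wcl_def)
      then have "(e, k) \<in> E \<times> {..<8}" using inc_subset[of u] copies_less[of e] by auto
      then have "Z e k \<in> all_vars" "Y e k \<in> all_vars" by (auto simp: all_vars_def)
      then show ?thesis using e(3) by auto
    qed (rule var_of_pad)
  next
    case (zunit e k)
    then have "(e, k) \<in> E \<times> {..<8}" using copies_less[of e] by auto
    then have "Z e k \<in> all_vars" by (auto simp: all_vars_def)
    then show ?thesis using l zunit(3) var_of_pad[of l "eid e k"] by (auto simp: zunit_def)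
  next
    case (yunit e k)
    then have "(e, k) \<in> E \<times> {..<8}" using copies_less[of e] by auto
    then have "Y e k \<in> all_vars" by (auto simp: all_vars_def)
    then show ?thesis using l yunit(3) var_of_pad[of l "eid e k"] by (auto simp: yunit_def)
  qed (use l in \<open>auto simp: all_vars_def chain_def\<close>)
  then show ?thesis by (auto simp: vars_def)
qed

lemma all_vars_range: "all_vars \<subseteq> range (to_nat :: gvar \<Rightarrow> nat)"
  by (auto simp: all_vars_def)

lemma flip_symmetry:
  assumes par: "\<And>u. \<not> par u \<Phi>" and card: "finite \<Phi>" "card \<Phi> \<le> 4"
  shows "k_symmetry 164 tseitin (flip \<Phi>)" "(`) (flip \<Phi>) ` tseitin = tseitin"
proof -
  have inv: "flip \<Phi> (flip \<Phi> l) = l" if "l \<in> lits tseitin" for l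
    using that vars_tseitin all_vars_range by (intro flip_flip) (auto simp: mem_lits_iff)
  have invC: "flip \<Phi> ` flip \<Phi> ` C = C" if "C \<in> tseitin" for C
  proof -
    have "(\<lambda>l. flip \<Phi> (flip \<Phi> l)) ` C = (\<lambda>l. l) ` C"
      using inv clause_subset_lits[OF that] by (intro image_cong) auto
    then show ?thesis by (simp add: image_image)
  qed
  have into: "flip \<Phi> l \<in> lits tseitin" if l: "l \<in> lits tseitin" for l
  proof -
    obtain C m where C: "C \<in> tseitin" "m \<in> C" "var_of m = var_of l"
      using l unfolding mem_lits_iff vars_def by (auto elim!: imageE)
    have "flip \<Phi> m \<in> lits tseitin"
      using clause_subset_lits[OF flip_clause[OF par C(1)]] C(2) by blast
    moreover have "l = m \<or> l = negate m" using C(3) by (cases l; cases m) auto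
    ultimately show ?thesis by (auto simp: flip_negate mem_lits_iff)
  qed
  have "bij_betw (flip \<Phi>) (lits tseitin) (lits tseitin)"
    by (rule bij_betw_byWitness[where f' = "flip \<Phi>"]) (use inv into in blast)+
  moreover have "card {x \<in> vars tseitin. flip \<Phi> (Pos x) \<noteq> Pos x} \<le> 164"
  proof -
    have "{x \<in> vars tseitin. flip \<Phi> (Pos x) \<noteq> Pos x} \<subseteq>
        X ` \<Phi> \<union> ((\<lambda>(e, k). Z e k) ` (\<Phi> \<times> {..<8}) \<union> (\<lambda>(e, k). Y e k) ` (\<Phi> \<times> {..<8}))"
    proof
      fix x assume "x \<in> {x \<in> vars tseitin. flip \<Phi> (Pos x) \<noteq> Pos x}"
      then have "x \<in> all_vars" "flip \<Phi> (Pos x) \<noteq> Pos x" using vars_tseitin by auto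
      then show "x \<in> X ` \<Phi> \<union> ((\<lambda>(e, k). Z e k) ` (\<Phi> \<times> {..<8}) \<union> (\<lambda>(e, k). Y e k) ` (\<Phi> \<times> {..<8}))"
        unfolding all_vars_def by (auto split: if_splits)
    qed
    then have "card {x \<in> vars tseitin. flip \<Phi> (Pos x) \<noteq> Pos x} \<le>
        card (X ` \<Phi> \<union> ((\<lambda>(e, k). Z e k) ` (\<Phi> \<times> {..<8}) \<union> (\<lambda>(e, k). Y e k) ` (\<Phi> \<times> {..<8})))"
      using card(1) by (intro card_mono) auto
    also have "\<dots> \<le> card (X ` \<Phi>) +
        (card ((\<lambda>(e, k). Z e k) ` (\<Phi> \<times> {..<8})) + card ((\<lambda>(e, k). Y e k) ` (\<Phi> \<times> {..<8})))"
      by (meson add_left_mono card_Un_le order_trans)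
    also have "\<dots> \<le> card \<Phi> + (card (\<Phi> \<times> {..<8::nat}) + card (\<Phi> \<times> {..<8::nat}))"
      using card(1) by (intro add_mono card_image_le) auto
    \<comment> \<open>With 8 as a bound on the copies, at most \<open>4 + 32 + 32 = 68\<close>
      variables move.\<close>
    also have "\<dots> \<le> 164" using card by (simp add: card_cartesian_product)
    finally show ?thesis .
  qed
  ultimately show "k_symmetry 164 tseitin (flip \<Phi>)"
    unfolding k_symmetry_def by (simp add: flip_negate)
  show "(`) (flip \<Phi>) ` tseitin = tseitin"
  proof (intro equalityI subsetI)
    fix C assume "C \<in> tseitin"
    then show "C \<in> (`) (flip \<Phi>) ` tseitin"
      using invC flip_clause[OF par] by (intro image_eqI[of _ _ "flip \<Phi> ` C"]) simp_all
  qed (use flip_clause[OF par] in blast)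
qed

section \<open>Deriving the unit clauses\<close>

definition sadm :: "(nat lit \<Rightarrow> nat lit) \<Rightarrow> nat cnf \<Rightarrow> bool" where
  "sadm = (\<lambda>\<phi> B. k_symmetry 164 tseitin \<phi> \<and> B = tseitin \<and> (`) \<phi> ` B = tseitin)"

abbreviation der :: "nat \<Rightarrow> nat clause set \<Rightarrow> bool" where
  "der \<equiv> derivable_within sadm tseitin"

lemma eliminate_units:
  assumes "der k K" "C \<in> K" "finite L" "card L \<le> m" "\<And>l. l \<in> L \<Longrightarrow> {negate l} \<in> K"
  shows "\<exists>K'. K \<subseteq> K' \<and> der (k + m) K' \<and> C - L \<in> K'"
proof -
  obtain C' K' where K': "K \<subseteq> K'" "C' \<in> K'" "der (k + card L) K'" "C - L \<subseteq> C'" "C' \<subseteq> (C - L) \<union> {}"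
    using derivable_within_eliminate[OF assms(3,1,2), of "{}"] assms(5) by blast
  then have "C' = C - L" by blast
  then show ?thesis using K' derivable_within_mono[OF K'(3)] assms(4) by auto
qed

definition base :: "nat clause set" where
  "base = (\<lambda>j. {Neg (P j)}) ` {..<M} \<union> {{Pos TA}, {Pos TB}}"

text \<open>The positive literals of \<open>chain j\<close> have larger indices, so the units follow
  by descending \<open>j\<close>, each from one input and at most \<open>M\<close> resolutions. The
  summand 3 counts the inputs for \<open>TA\<close> and \<open>TB\<close> and the removal of
  \<open>P 0\<close>.\<close>

lemma derive_base: "\<exists>K. base \<subseteq> K \<and> der (3 + (1 + M) * M) K"
proof -
  have der1: "der 1 {{Pos TA}}"
    using derivable_within_input[OF derivable_within_empty tseitin_intros(1)] by simp
  have "\<exists>K'. {{Pos TA}} \<subseteq> K' \<and> der (1 + (1 + M) * card {..<M}) K' \<and> (\<forall>j\<in>{..<M}. {Neg (P j)} \<in> K')"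
  proof (rule derivable_within_ranked[where rank = "\<lambda>j. M - j"])
    fix j k' K'
    assume j: "j \<in> {..<M}" and K': "der k' K'"
      and IH: "\<And>i. i \<in> {..<M} \<Longrightarrow> M - i < M - j \<Longrightarrow> {Neg (P i)} \<in> K'"
    have 1: "der (Suc k') (insert (chain j) K')"
      using K' j by (intro derivable_within_input tseitin_intros) simp_all
    let ?L = "(\<lambda>i. Pos (P i)) ` {j<..<M}"
    have "card ?L \<le> M" by (rule order_trans[OF card_image_le]) simp_all
    moreover have "{negate l} \<in> insert (chain j) K'" if "l \<in> ?L" for l
      using that IH by auto
    ultimately obtain K'' where K'': "insert (chain j) K' \<subseteq> K''" "der (Suc k' + M) K''" "chain j - ?L \<in> K''"
      using eliminate_units[OF 1, of "chain j" ?L M] by auto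
    moreover have "chain j - ?L = {Neg (P j)}" by (auto simp: chain_def)
    ultimately show "\<exists>K''. K' \<subseteq> K'' \<and> der (k' + (1 + M)) K'' \<and> {Neg (P j)} \<in> K''"
      by (intro exI[of _ K'']) auto
  qed (use der1 in auto)
  then obtain K1 where K1: "{Pos TA} \<in> K1" "der (1 + (1 + M) * M) K1" "\<And>j. j < M \<Longrightarrow> {Neg (P j)} \<in> K1"
    by auto
  have 2: "der (Suc (1 + (1 + M) * M)) (insert {Pos TB, Pos (P 0)} K1)"
    by (intro derivable_within_input K1 tseitin_intros)
  have "0 < M" by (simp add: M_def)
  then obtain K2 where K2: "insert {Pos TB, Pos (P 0)} K1 \<subseteq> K2" "der (Suc (1 + (1 + M) * M) + 1) K2"
    "{Pos TB, Pos (P 0)} - {Pos (P 0)} \<in> K2"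
    using eliminate_units[OF 2, of "{Pos TB, Pos (P 0)}" "{Pos (P 0)}" 1] K1(3) by auto
  have "{Pos TB, Pos (P 0)} - {Pos (P 0)} = {Pos TB :: nat lit}" by auto
  then have "base \<subseteq> K2" using K1 K2 by (auto simp: base_def)
  moreover have "der (3 + (1 + M) * M) K2" using K2(2) by (rule derivable_within_mono) simp
  ultimately show ?thesis by blast
qed

lemma pad_units:
  assumes "base \<subseteq> K" "l \<in> pad i" "i \<in> ids"
  shows "{negate l} \<in> K"
proof -
  have "32 * idn i < M" using idn_le_M assms(3) by simp
  then have "{negate l} \<in> base" using assms(2) by (auto simp: pad_def base_def)
  then show ?thesis using assms(1) by blast
qed

lemma card_pad: "i \<in> ids \<Longrightarrow> card (pad i) \<le> M + 2"
proof -
  assume "i \<in> ids"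
  then have "32 * idn i < M" by (rule idn_le_M)
  moreover have "card (pad i) \<le> card ((\<lambda>j. Pos (P j)) ` {..<32 * idn i}) + card {Neg TA, Neg TB :: nat lit}"
    unfolding pad_def by (rule card_Un_le)
  moreover have "card ((\<lambda>j. Pos (P j)) ` {..<32 * idn i}) \<le> 32 * idn i"
    by (rule order_trans[OF card_image_le]) simp_all
  moreover have "card {Neg TA, Neg TB :: nat lit} = 2" by simp
  ultimately show ?thesis by linarith
qed

definition slots :: "(edge \<times> nat) set" where
  "slots = (SIGMA e:E. {..<copies e})"

definition units :: "nat clause set" where
  "units = base \<union> (\<lambda>(e, k). {Neg (Z e k)}) ` slots \<union> (\<lambda>(e, k). {Pos (Y e k)}) ` slots"

lemma finite_slots: "finite slots"
  by (simp add: slots_def finite_E)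

lemma card_slots: "card slots \<le> 16 * N ^ 2"
proof -
  have "slots \<subseteq> E \<times> {..<8}" using copies_less by (auto simp: slots_def intro: less_trans)
  then have "card slots \<le> card (E \<times> {..<8::nat})" by (intro card_mono) (simp_all add: finite_E)
  then show ?thesis using card_E by (simp add: card_cartesian_product)
qed

lemma derive_units: "\<exists>K. units \<subseteq> K \<and> der (3 + (1 + M) * M + (2 * M + 6) * card slots) K"
proof -
  obtain K0 where K0: "base \<subseteq> K0" "der (3 + (1 + M) * M) K0" using derive_base by blast
  have "\<exists>K'. K0 \<subseteq> K' \<and> der (3 + (1 + M) * M + (2 * M + 6) * card slots) K' \<and>
      (\<forall>s\<in>slots. {Neg (Z (fst s) (snd s))} \<in> K' \<and> {Pos (Y (fst s) (snd s))} \<in> K')"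
  \<comment> \<open>These units depend only on \<open>base\<close> and not on each other, hence the
    constant rank. Each slot costs two inputs and two pads of at most \<open>M + 2\<close>
    literals.\<close>
  proof (rule derivable_within_ranked[where rank = "\<lambda>_. 0"])
    fix s k' K'
    assume s: "s \<in> slots" and K': "K0 \<subseteq> K'" "der k' K'"
    obtain e k where ek: "s = (e, k)" "e \<in> E" "k < copies e" using s by (auto simp: slots_def)
    have id: "eid e k \<in> ids" using eid_in ek by blast
    have 1: "der (Suc k') (insert (zunit e k) K')"
      using K' ek by (intro derivable_within_input tseitin_intros)
    have "{negate l} \<in> insert (zunit e k) K'" if "l \<in> pad (eid e k)" for l
      using pad_units[OF _ that id, of K'] K0(1) K'(1) by auto
    then obtain K1 where K1: "insert (zunit e k) K' \<subseteq> K1" "der (Suc k' + (M + 2)) K1"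
        "zunit e k - pad (eid e k) \<in> K1"
      using eliminate_units[OF 1, of "zunit e k" "pad (eid e k)" "M + 2"] finite_pad card_pad[OF id] by auto
    have 2: "der (Suc (Suc k' + (M + 2))) (insert (yunit e k) K1)"
      using K1 ek by (intro derivable_within_input tseitin_intros)
    have "{negate l} \<in> insert (yunit e k) K1" if "l \<in> pad (eid e k)" for l
      using pad_units[OF _ that id, of K1] K0(1) K'(1) K1(1) by auto
    then obtain K2 where K2: "insert (yunit e k) K1 \<subseteq> K2" "der (Suc (Suc k' + (M + 2)) + (M + 2)) K2"
        "yunit e k - pad (eid e k) \<in> K2"
      using eliminate_units[OF 2, of "yunit e k" "pad (eid e k)" "M + 2"] finite_pad card_pad[OF id] by auto
    have "zunit e k - pad (eid e k) = {Neg (Z e k)}" "yunit e k - pad (eid e k) = {Pos (Y e k)}"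
      by (auto simp: zunit_def yunit_def pad_def)
    moreover have "der (k' + (2 * M + 6)) K2"
      using K2(2) by (rule derivable_within_mono) simp
    ultimately show "\<exists>K''. K' \<subseteq> K'' \<and> der (k' + (2 * M + 6)) K'' \<and>
        {Neg (Z (fst s) (snd s))} \<in> K'' \<and> {Pos (Y (fst s) (snd s))} \<in> K''"
      using K1 K2(1,3) ek(1) by (intro exI[of _ K2]) auto
  qed (use K0 finite_slots in auto)
  then obtain K' where K': "K0 \<subseteq> K'" "der (3 + (1 + M) * M + (2 * M + 6) * card slots) K'"
    and K'_slots: "\<forall>s\<in>slots. {Neg (Z (fst s) (snd s))} \<in> K' \<and> {Pos (Y (fst s) (snd s))} \<in> K'"
    by blast
  have "{Neg (Z e k)} \<in> K' \<and> {Pos (Y e k)} \<in> K'" if "(e, k) \<in> slots" for e k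
    using bspec[OF K'_slots that] by simp
  then have "units \<subseteq> K'" using K0(1) K'(1) by (auto simp: units_def)
  then show ?thesis using K'(2) by blast
qed

lemma card_inc: "card (inc u) \<le> 4"
proof -
  have "card (inc u) = card (colour ` inc u)" using colour_inj by (simp add: card_image)
  also have "\<dots> \<le> card {..<4::nat}" using colour_less by (intro card_mono) auto
  finally show ?thesis by simp
qed

lemma card_wcl: "card (wcl u T) \<le> 64"
proof -
  have "(SIGMA e:A. {..<copies e}) \<subseteq> A \<times> {..<8}" for A
    using copies_less by (auto intro: less_trans)
  then have "wcl u T \<subseteq> (\<lambda>(e, k). Pos (Z e k)) ` (inc u \<times> {..<8}) \<union> (\<lambda>(e, k). Neg (Y e k)) ` (inc u \<times> {..<8})"
    unfolding wcl_def by blast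
  then have "card (wcl u T) \<le>
      card ((\<lambda>(e, k). Pos (Z e k)) ` (inc u \<times> {..<8}) \<union> (\<lambda>(e, k). Neg (Y e k)) ` (inc u \<times> {..<8}))"
    using finite_inc by (intro card_mono) auto
  also have "\<dots> \<le> card ((\<lambda>(e, k). Pos (Z e k)) ` (inc u \<times> {..<8})) + card ((\<lambda>(e, k). Neg (Y e k)) ` (inc u \<times> {..<8}))"
    by (rule card_Un_le)
  also have "\<dots> \<le> card (inc u \<times> {..<8::nat}) + card (inc u \<times> {..<8::nat})"
    using finite_inc by (intro add_mono card_image_le) auto
  also have "\<dots> \<le> 64" using card_inc[of u] by (simp add: card_cartesian_product)
  finally show ?thesis .
qed

lemma derive_xcl:
  assumes "units \<subseteq> K" "der k K" "u \<in> V" "T \<subseteq> inc u" "odd (card T) \<noteq> (u = (0, 0))"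
  shows "\<exists>K'. K \<subseteq> K' \<and> der (k + (M + 67)) K' \<and> xcl u T \<in> K'"
proof -
  let ?L = "wcl u T \<union> pad (vid u)"
  have id: "vid u \<in> ids" using vid_in assms(3) by blast
  have 1: "der (Suc k) (insert (vcl u T) K)"
    using assms by (intro derivable_within_input tseitin_intros)
  have "{negate l} \<in> insert (vcl u T) K" if "l \<in> ?L" for l
  proof (cases "l \<in> pad (vid u)")
    case True
    then show ?thesis using pad_units[OF _ True id, of K] assms(1) by (auto simp: units_def)
  next
    case False
    then obtain e k where "(e, k) \<in> slots" "l = Pos (Z e k) \<or> l = Neg (Y e k)"
      using \<open>l \<in> ?L\<close> inc_subset[of u] by (auto simp: wcl_def slots_def)
    then have "{negate l} \<in> units" unfolding units_def by (force intro: rev_image_eqI)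
    then show ?thesis using assms(1) by blast
  qed
  moreover have "card ?L \<le> 64 + (M + 2)"
    by (rule order_trans[OF card_Un_le add_mono[OF card_wcl card_pad[OF id]]])
  ultimately obtain K1 where K1: "insert (vcl u T) K \<subseteq> K1" "der (Suc k + (64 + (M + 2))) K1" "vcl u T - ?L \<in> K1"
    using eliminate_units[OF 1, of "vcl u T" ?L "64 + (M + 2)"] finite_pad finite_wcl by auto
  have "vcl u T - ?L = xcl u T"
    by (auto simp: vcl_def xcl_def wcl_def pad_def)
  moreover have "der (k + (M + 67)) K1" using K1(2) by (rule derivable_within_mono) simp
  ultimately show ?thesis using K1 by auto
qed

text \<open>The edges that are not pivots form a spanning tree: row \<open>0\<close> together with all columns,
  rooted at \<open>(0, 0)\<close>.\<close>

definition pivots :: "edge set" where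
  "pivots = {(d, a, k) \<in> E. \<not> d \<and> a > 0}"

definition plits :: "nat clause" where
  "plits = (\<lambda>e. Pos (X e)) ` pivots"

text \<open>The tree edge from \<open>u\<close> towards the root: along the column down to row
  \<open>0\<close>, then along row \<open>0\<close>.\<close>

definition parent :: "nat \<times> nat \<Rightarrow> edge" where
  "parent u = (if fst u > 0 then (True, snd u, fst u - 1) else (False, 0, snd u - 1))"

lemma parent_inc: "u \<in> V \<Longrightarrow> u \<noteq> (0, 0) \<Longrightarrow> parent u \<in> inc u"
  by (cases u) (auto simp: parent_def inc_iff E_iff crd_def V_def)

text \<open>The sum of the coordinates is the depth in the tree, so a tree edge at \<open>u\<close>
  leads either to its parent or to a vertex one level deeper.\<close>

lemma tree_edge_cases:
  assumes "u \<in> V" "e \<in> inc u" "e \<notin> pivots"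
  shows "u \<noteq> (0, 0) \<and> e = parent u \<or>
    (\<exists>w\<in>V. w \<noteq> (0, 0) \<and> e = parent w \<and> fst w + snd w = Suc (fst u + snd u))"
proof -
  obtain d a k r c where [simp]: "e = (d, a, k)" "u = (r, c)" by (metis prod_cases3 surj_pair)
  show ?thesis
  proof (cases d)
    case True
    then have e: "a = c" "r = k \<or> r = Suc k" "Suc k < N" "c < N"
      using assms by (auto simp: inc_iff E_iff crd_def)
    then have "r = k \<Longrightarrow> e = parent (Suc k, c) \<and> (Suc k, c) \<in> V" "r = Suc k \<Longrightarrow> e = parent u"
      using True by (auto simp: parent_def V_def)
    then show ?thesis using e by force
  next
    case False
    then have e: "a = r" "c = k \<or> c = Suc k" "Suc k < N" "r = 0"
      using assms by (auto simp: inc_iff E_iff crd_def pivots_def)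
    then have "c = k \<Longrightarrow> e = parent (0, Suc k) \<and> (0, Suc k) \<in> V" "c = Suc k \<Longrightarrow> e = parent u"
      using False by (auto simp: parent_def V_def)
    then show ?thesis using e by force
  qed
qed

text \<open>If all pivots and all edges to children are false, an uncharged vertex forces its parent
  edge to be false as well; the excluded set is then \<open>{parent u}\<close>. At the charged root
  the excluded set is empty, which leaves only pivots. At most 4 tree edges are removed in addition
  to the padding.\<close>

lemma derive_vertex:
  assumes "units \<subseteq> K" "der k K" "u \<in> V" "T \<subseteq> inc u" "odd (card T) \<noteq> (u = (0, 0))"
    and T: "T = (if u = (0, 0) then {} else {parent u})"
    and children: "\<And>w. w \<in> V \<Longrightarrow> w \<noteq> (0, 0) \<Longrightarrow> fst w + snd w = Suc (fst u + snd u) \<Longrightarrow>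
      \<exists>Q\<subseteq>plits. insert (Neg (X (parent w))) Q \<in> K"
  shows "\<exists>K' C. K \<subseteq> K' \<and> der (k + (M + 71)) K' \<and> C \<in> K' \<and>
    (\<lambda>e. Neg (X e)) ` T \<subseteq> C \<and> C \<subseteq> (\<lambda>e. Neg (X e)) ` T \<union> plits"
proof -
  obtain K1 where K1: "K \<subseteq> K1" "der (k + (M + 67)) K1" "xcl u T \<in> K1"
    using derive_xcl[OF assms(1-5)] by blast
  let ?L = "(\<lambda>e. Pos (X e)) ` (inc u - T - pivots)"
  have "\<exists>Q\<subseteq>plits. insert (negate l) Q \<in> K1" if l: "l \<in> ?L" for l
  proof -
    obtain e where e: "l = Pos (X e)" "e \<in> inc u" "e \<notin> T" "e \<notin> pivots" using l by blast
    have "\<not> (u \<noteq> (0, 0) \<and> e = parent u)" using e(3) T by auto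
    then obtain w where w: "w \<in> V" "w \<noteq> (0, 0)" "e = parent w" "fst w + snd w = Suc (fst u + snd u)"
      using tree_edge_cases[OF assms(3) e(2,4)] by blast
    then show ?thesis using children[OF w(1,2,4)] K1(1) e(1) by auto
  qed
  moreover have "finite ?L" "?L \<inter> plits = {}" using finite_inc by (auto simp: plits_def)
  ultimately obtain C K2 where K2: "K1 \<subseteq> K2" "C \<in> K2" "der (k + (M + 67) + card ?L) K2"
    "xcl u T - ?L \<subseteq> C" "C \<subseteq> (xcl u T - ?L) \<union> plits"
    using derivable_within_eliminate[OF _ K1(2,3), of ?L plits] by blast
  have "card ?L \<le> card (inc u - T - pivots)" using finite_inc by (intro card_image_le) simp
  also have "\<dots> \<le> card (inc u)" using finite_inc by (intro card_mono) auto
  also have "\<dots> \<le> 4" by (rule card_inc)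
  finally have "der (k + (M + 71)) K2" using derivable_within_mono[OF K2(3)] by simp
  moreover have "(\<lambda>e. Neg (X e)) ` T \<subseteq> xcl u T - ?L" using assms(4) by (auto simp: xcl_def)
  then have "(\<lambda>e. Neg (X e)) ` T \<subseteq> C" using K2(4) by (rule subset_trans)
  moreover have "xcl u T - ?L \<subseteq> (\<lambda>e. Neg (X e)) ` T \<union> plits"
    by (auto simp: xcl_def plits_def)
  then have "C \<subseteq> (\<lambda>e. Neg (X e)) ` T \<union> plits" using K2(5) by blast
  moreover have "K \<subseteq> K2" using K1(1) K2(1) by (rule subset_trans)
  ultimately show ?thesis using K2(2) by (intro exI[of _ K2] exI[of _ C]) simp
qed

lemma derive_pivot_clause:
  "\<exists>K C. der (3 + (1 + M) * M + (2 * M + 6) * card slots + (M + 71) * (N ^ 2 + 1)) K \<and> C \<in> K \<and> C \<subseteq> plits"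
proof -
  let ?k = "3 + (1 + M) * M + (2 * M + 6) * card slots"
  obtain K0 where K0: "units \<subseteq> K0" "der ?k K0" using derive_units by blast
  let ?G = "\<lambda>u K. \<exists>Q\<subseteq>plits. insert (Neg (X (parent u))) Q \<in> K"
  have "\<exists>K'. K0 \<subseteq> K' \<and> der (?k + (M + 71) * card (V - {(0, 0)})) K' \<and> (\<forall>u\<in>V - {(0, 0)}. ?G u K')"
  \<comment> \<open>Deeper vertices come first, since a vertex uses the clauses of its
    children.\<close>
  proof (rule derivable_within_ranked[where rank = "\<lambda>u. 2 * N - (fst u + snd u)"])
    fix u k' K'
    assume u: "u \<in> V - {(0, 0)}" and K': "K0 \<subseteq> K'" "der k' K'"
      and IH: "\<And>w. w \<in> V - {(0, 0)} \<Longrightarrow> 2 * N - (fst w + snd w) < 2 * N - (fst u + snd u) \<Longrightarrow> ?G w K'"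
    have "fst u + snd u < 2 * N" using u by (auto simp: V_def)
    then have ch: "?G w K'" if "w \<in> V" "w \<noteq> (0, 0)" "fst w + snd w = Suc (fst u + snd u)" for w
      using that by (intro IH) auto
    have uV: "u \<in> V" "u \<noteq> (0, 0)" using u by auto
    have "\<exists>K'' C. K' \<subseteq> K'' \<and> der (k' + (M + 71)) K'' \<and> C \<in> K'' \<and>
        (\<lambda>e. Neg (X e)) ` {parent u} \<subseteq> C \<and> C \<subseteq> (\<lambda>e. Neg (X e)) ` {parent u} \<union> plits"
    proof (rule derive_vertex[OF _ K'(2) uV(1)])
      show "units \<subseteq> K'" using K0(1) K'(1) by blast
      show "{parent u} \<subseteq> inc u" using parent_inc[OF uV] by simp
    qed (use uV ch in simp_all)
    then obtain K'' C where K'': "K' \<subseteq> K''" "der (k' + (M + 71)) K''" "C \<in> K''"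
      "(\<lambda>e. Neg (X e)) ` {parent u} \<subseteq> C" "C \<subseteq> (\<lambda>e. Neg (X e)) ` {parent u} \<union> plits"
      by blast
    then have "insert (Neg (X (parent u))) (C - {Neg (X (parent u))}) = C" "C - {Neg (X (parent u))} \<subseteq> plits"
      by auto
    then have "?G u K''" using K''(3) by metis
    then show "\<exists>K''. K' \<subseteq> K'' \<and> der (k' + (M + 71)) K'' \<and> ?G u K''" using K'' by blast
  next
    show "\<And>u K' K''. ?G u K' \<Longrightarrow> K' \<subseteq> K'' \<Longrightarrow> ?G u K''" by blast
  qed (use K0 finite_V in simp_all)
  then obtain K1 where K1: "K0 \<subseteq> K1" "der (?k + (M + 71) * card (V - {(0, 0)})) K1"
    "\<And>u. u \<in> V \<Longrightarrow> u \<noteq> (0, 0) \<Longrightarrow> ?G u K1" by blast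
  have "\<exists>K2 C. K1 \<subseteq> K2 \<and> der (?k + (M + 71) * card (V - {(0, 0)}) + (M + 71)) K2 \<and> C \<in> K2 \<and>
      (\<lambda>e. Neg (X e)) ` {} \<subseteq> C \<and> C \<subseteq> (\<lambda>e. Neg (X e)) ` {} \<union> plits"
  proof (rule derive_vertex[OF _ K1(2), of "(0, 0)"])
    show "units \<subseteq> K1" using K0(1) K1(1) by blast
    show "(0, 0) \<in> V" by (simp add: V_def N_def)
  qed (use K1(3) in simp_all)
  then obtain K2 C where K2: "der (?k + (M + 71) * card (V - {(0, 0)}) + (M + 71)) K2" "C \<in> K2" "C \<subseteq> plits"
    by auto
  have "card (V - {(0, 0)}) \<le> N ^ 2" using card_V finite_V by (metis card_Diff1_le)
  then have "(M + 71) * card (V - {(0, 0)}) + (M + 71) \<le> (M + 71) * (N ^ 2 + 1)"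
    by (metis add_mult_distrib2 add_le_mono1 mult.right_neutral mult_le_mono2)
  then show ?thesis using derivable_within_mono[OF K2(1)] K2(2,3)
    by (metis (no_types, lifting) add.assoc add_left_mono)
qed

section \<open>Removing the pivots by symmetry\<close>

text \<open>The face below a pivot of the lowest row in \<open>R\<close> contains no other edge of
  \<open>R\<close>: its other horizontal edge lies in a lower row, and vertical edges are not
  pivots. So its flip negates just this literal of \<open>C\<close>, and resolving \<open>C\<close>
  with its image deletes the literal. A pivot costs at most two lines.\<close>

lemma eliminate_pivots:
  assumes "R \<subseteq> pivots" "der k K" "C \<in> K" "C \<subseteq> (\<lambda>e. Pos (X e)) ` R"
  shows "\<exists>K'. der (k + 2 * card R) K' \<and> {} \<in> K'"
  using assms
proof (induction "card R" arbitrary: R k K C)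
  case 0
  have "finite R" using 0(2) finite_E finite_subset[of R E] by (auto simp: pivots_def)
  then have "R = {}" using 0(1) by simp
  then have "C = {}" using 0(5) by simp
  then show ?case using 0(3,4) \<open>R = {}\<close> by auto
next
  case (Suc m)
  have R: "finite R" "R \<noteq> {}" using Suc.hyps(2) card.infinite by fastforce+
  \<comment> \<open>The component \<open>fst (snd e)\<close> is the row, so \<open>e\<close> lies in
    the lowest row that occurs in \<open>R\<close>.\<close>
  obtain e where e: "e \<in> R" "\<And>e'. e' \<in> R \<Longrightarrow> fst (snd e) \<le> fst (snd e')"
    using ex_min_if_finite[of "(fst \<circ> snd) ` R"] R by (force simp: not_less)
  obtain a k' where ek: "e = (False, Suc a, k')" "Suc a < N" "Suc k' < N"
  proof -
    have "e \<in> pivots" using e(1) Suc.prems(1) by blast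
    then obtain a' k' where "e = (False, a', k')" "a' > 0" "a' < N" "Suc k' < N"
      by (auto simp: pivots_def E_iff)
    then show ?thesis using that[of "a' - 1" k'] by simp
  qed
  have card: "card R = Suc (card (R - {e}))" by (rule card.remove[OF R(1) e(1)])
  then have m: "m = card (R - {e})" using Suc.hyps(2) by simp
  show ?case
  proof (cases "Pos (X e) \<in> C")
    case False
    then have "C \<subseteq> (\<lambda>e. Pos (X e)) ` (R - {e})" using Suc.prems(4) by auto
    then obtain K' where "der (k + 2 * card (R - {e})) K'" "{} \<in> K'"
      using Suc.hyps(1)[OF m _ Suc.prems(2,3)] Suc.prems(1) by blast
    then show ?thesis using derivable_within_mono card by (metis add_le_cancel_left le_SucI mult_le_mono2 order_refl)
  next
    case True
    define \<Phi> where "\<Phi> = face False a k'"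
    have "finite \<Phi>" "card \<Phi> \<le> 4"
      by (simp_all add: \<Phi>_def face_def card_insert_if)
    note sym = flip_symmetry[OF par_face[OF ek(2,3), of _ False, folded \<Phi>_def] this]
    have e_in: "e \<in> \<Phi>" by (simp add: \<Phi>_def face_def ek(1))
    have other: "e' \<notin> \<Phi>" if "e' \<in> R" "e' \<noteq> e" for e'
    proof -
      obtain d a' k'' where e': "e' = (d, a', k'')" by (cases e')
      have "\<not> d" "Suc a \<le> a'" using that e(2)[OF that(1)] Suc.prems(1) by (auto simp: pivots_def e' ek(1))
      then show ?thesis using that(2) by (auto simp: \<Phi>_def face_def e' ek(1))
    qed
    have "flip \<Phi> ` (C - {Pos (X e)}) = id ` (C - {Pos (X e)})"
    proof (rule image_cong[OF refl])
      fix l assume "l \<in> C - {Pos (X e)}"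
      then obtain e' where "l = Pos (X e')" "e' \<in> R" "e' \<noteq> e" using Suc.prems(4) by blast
      then show "flip \<Phi> l = id l" using other by simp
    qed
    moreover have "flip \<Phi> ` C = insert (flip \<Phi> (Pos (X e))) (flip \<Phi> ` (C - {Pos (X e)}))"
      using True by blast
    ultimately have flip: "flip \<Phi> ` C = insert (Neg (X e)) (C - {Pos (X e)})"
      using e_in by simp
    have 1: "der (Suc k) (insert (flip \<Phi> ` C) K)"
      using derivable_within_global_symmetry[of 164 tseitin k K C "flip \<Phi>"] Suc.prems(2,3) sym
      by (simp add: sadm_def)
    have 2: "der (Suc (Suc k)) (insert (resolvent (X e) C (flip \<Phi> ` C)) (insert (flip \<Phi> ` C) K))"
      using Suc.prems(3) True flip by (intro derivable_within_resolvent[OF 1]) auto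
    have res: "resolvent (X e) C (flip \<Phi> ` C) = C - {Pos (X e)}"
      using Suc.prems(4) unfolding flip resolvent_def by auto
    have "C - {Pos (X e)} \<subseteq> (\<lambda>e. Pos (X e)) ` (R - {e})" using Suc.prems(4) by auto
    then obtain K' where "der (Suc (Suc k) + 2 * card (R - {e})) K'" "{} \<in> K'"
      using Suc.hyps(1)[OF m _ 2, of "C - {Pos (X e)}"] Suc.prems(1) res by auto
    then show ?thesis using card by auto
  qed
qed

lemma SRC_I_upper_bound: "\<exists>\<pi>. SRC_I_proof 164 tseitin \<pi> \<and> length \<pi> \<le> 300000 * N ^ 4"
proof -
  \<comment> \<open>Every summand is bounded by a multiple of \<open>q * q\<close>; the multiples
    add up to less than 300000.\<close>
  define q where "q = N ^ 2"
  have q: "1 \<le> q" by (simp add: q_def N_def)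
  then have qq: "q \<le> q * q" by simp
  let ?k = "3 + (1 + M) * M + (2 * M + 6) * card slots + (M + 71) * (N ^ 2 + 1)"
  obtain K C where K: "der ?k K" "C \<in> K" "C \<subseteq> plits" using derive_pivot_clause by blast
  then obtain K' where K': "der (?k + 2 * card pivots) K'" "{} \<in> K'"
    using eliminate_pivots[of pivots ?k K C] by (auto simp: plits_def)
  have M: "M \<le> 513 * q" using q by (simp add: M_def q_def)
  have "card pivots \<le> card E" by (intro card_mono finite_E) (auto simp: pivots_def)
  then have piv: "card pivots \<le> 2 * q" using card_E by (simp add: q_def)
  have slots: "card slots \<le> 16 * q" using card_slots by (simp add: q_def)
  have "(1 + M) * M \<le> (514 * q) * (513 * q)" using M q by (intro mult_mono) simp_all
  moreover have "(2 * M + 6) * card slots \<le> (1032 * q) * (16 * q)"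
    using M q slots by (intro mult_mono) simp_all
  moreover have "(M + 71) * (N ^ 2 + 1) \<le> (584 * q) * (2 * q)"
    using M q by (intro mult_mono) (simp_all add: q_def[symmetric])
  ultimately have "?k + 2 * card pivots \<le> 300000 * (q * q)"
    using piv q qq by linarith
  also have "q * q = N ^ 4" by (simp add: q_def power_numeral_reduce)
  finally have le: "?k + 2 * card pivots \<le> 300000 * N ^ 4" .
  obtain \<pi> where "refutation sadm tseitin \<pi>" "length \<pi> \<le> ?k + 2 * card pivots"
    using refutation_of_derivable_within[OF K'] by blast
  then show ?thesis using le unfolding SRC_I_proof_def sadm_def[symmetric] by (meson le_trans)
qed

section \<open>Bounds on the shortest proofs\<close>

lemma unsatisfiable_tseitin: "unsatisfiable tseitin"
  using SRC_I_upper_bound SRC_I_sound by blast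

lemma shortest_SRC_I: "shortest_size (SRC_I_proof 164 tseitin) \<le> 300000 * N ^ 4"
proof -
  obtain \<pi> where \<pi>: "SRC_I_proof 164 tseitin \<pi>" "length \<pi> \<le> 300000 * N ^ 4"
    using SRC_I_upper_bound by blast
  have "shortest_size (SRC_I_proof 164 tseitin) \<le> length \<pi>"
    unfolding shortest_size_def by (rule Least_le) (use \<pi>(1) in blast)
  then show ?thesis using \<pi>(2) by simp
qed

lemma shortest_SR_II:
  assumes "n > 0"
  shows "4 ^ n \<le> 2 * shortest_size (SR_II_proof tseitin) * 3 ^ n"
proof -
  obtain \<pi> where "refutation adm tseitin \<pi>"
    using resolution_complete[OF is_cnf_tseitin unsatisfiable_tseitin] by blast
  then have "\<exists>s \<pi>. SR_II_proof tseitin \<pi> \<and> length \<pi> = s" by (auto simp: SR_II_proof_iff)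
  then have "\<exists>\<pi>. SR_II_proof tseitin \<pi> \<and> length \<pi> = shortest_size (SR_II_proof tseitin)"
    unfolding shortest_size_def by (rule LeastI_ex)
  then show ?thesis using SR_II_lower_bound[OF assms] by metis
qed

end

theorem theorem38:
  "\<exists>\<tau> :: nat \<Rightarrow> nat cnf.
     (\<forall>n. is_cnf (\<tau> n) \<and> unsatisfiable (\<tau> n)) \<and>
     polynomial (\<lambda>n. shortest_size (SRC_I_proof 164 (\<tau> n))) \<and>
     exponential (\<lambda>n. shortest_size (SR_II_proof (\<tau> n)))"
proof (intro exI[of _ grid.tseitin] conjI allI)
  fix n
  show "is_cnf (grid.tseitin n)" by (rule grid.is_cnf_tseitin)
  show "unsatisfiable (grid.tseitin n)" by (rule grid.unsatisfiable_tseitin)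
next
  have "(\<lambda>n. real (shortest_size (SRC_I_proof 164 (grid.tseitin n)))) \<in> O(\<lambda>n. real n ^ 4)"
  proof (rule bigoI)
    show "\<forall>\<^sub>F n in sequentially. norm (real (shortest_size (SRC_I_proof 164 (grid.tseitin n)))) \<le>
        300000 * 81 * norm (real n ^ 4)"
      using eventually_gt_at_top[of 0]
    proof eventually_elim
      case (elim n)
      \<comment> \<open>\<open>2 * n + 1 \<le> 3 * n\<close> for positive \<open>n\<close>; the
        factor 81 is \<open>3 ^ 4\<close>.\<close>
      have "grid.N n \<le> 3 * n" using elim by (simp add: grid.N_def)
      then have "grid.N n ^ 4 \<le> (3 * n) ^ 4" by (rule power_mono) simp
      also have "\<dots> = 81 * n ^ 4" by (simp add: power_mult_distrib)
      finally have "shortest_size (SRC_I_proof 164 (grid.tseitin n)) \<le> 300000 * (81 * n ^ 4)"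
        using grid.shortest_SRC_I[of n] by simp
      then have "real (shortest_size (SRC_I_proof 164 (grid.tseitin n))) \<le> real (300000 * (81 * n ^ 4))"
        by (rule of_nat_mono)
      then show ?case by simp
    qed
  qed
  then show "polynomial (\<lambda>n. shortest_size (SRC_I_proof 164 (grid.tseitin n)))"
    unfolding polynomial_def by blast
next
  let ?s = "\<lambda>n. shortest_size (SR_II_proof (grid.tseitin n))"
  \<comment> \<open>The rate 4/3 splits as 8/7 times 7/6: \<open>(8/7) ^ 6\<close> exceeds 2 and
    absorbs the factor 2 of the lower bound once \<open>n \<ge> 6\<close>, while
    \<open>(7/6) ^ 5\<close> exceeds 2 and gives the exponent 1/5.\<close>
  have "2 powr (1/5 * real n) \<le> real (?s n)" if "n \<ge> 6" for n
  proof -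
    have "(2 powr (1/5)) ^ 5 = (2::real)" by (simp add: powr_realpow[symmetric] powr_powr)
    then have "(2 powr (1/5)) ^ 5 \<le> (7/6::real) ^ 5" by (simp add: power_divide eval_nat_numeral)
    then have c: "2 powr (1/5) \<le> (7/6::real)" 
      using power_mono_iff[of "2 powr (1/5)" "7/6::real" 5] by simp
    have "2 powr (1/5 * real n) = (2 powr (1/5)) powr real n" by (simp only: powr_powr)
    also have "\<dots> = (2 powr (1/5)) ^ n" by (simp add: powr_realpow)
    also have "\<dots> \<le> (7/6) ^ n" using c by (intro power_mono) simp_all
    finally have 1: "2 powr (1/5 * real n) \<le> (7/6) ^ n" .
    have "2 \<le> (8/7::real) ^ 6" by (simp add: power_divide eval_nat_numeral)
    also have "\<dots> \<le> (8/7) ^ n" using that by (intro power_increasing) simp_all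
    finally have "2 * (7/6) ^ n \<le> (8/7) ^ n * (7/6::real) ^ n" by (intro mult_right_mono) simp_all
    also have "\<dots> = (4/3) ^ n" by (simp add: power_mult_distrib[symmetric])
    finally have 2: "2 * (7/6) ^ n \<le> (4/3::real) ^ n" .
    have "real (4 ^ n) \<le> real (2 * ?s n * 3 ^ n)"
      by (rule of_nat_mono[OF grid.shortest_SR_II]) (use that in simp)
    then have "(4/3) ^ n \<le> 2 * real (?s n)" by (simp add: power_divide field_simps)
    then show ?thesis using 1 2 by simp
  qed
  then have "\<forall>\<^sub>F n in sequentially. real (?s n) \<ge> 2 powr (1/5 * real n)"
    unfolding eventually_sequentially by blast
  then show "exponential ?s" unfolding exponential_def by (intro exI[of _ "1/5"]) simp
qed

end
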